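(* Let $\mu^\pm$ be probability measures on $\mathbb{R}^d$ with compact supports $X^\pm$, and let $c\in\mathscr{C}(X^-\times X^+)$. Then the function $\varepsilon\mapsto v_\varepsilon$ is continuous, non-decreasing and concave on $[0,+\infty)$, and it is analytic on $(0,+\infty)$.
   Context: Let $\Pi(\mu^-,\mu^+)$ be the set of probability measures on $X^-\times X^+$ with marginals $\mu^-$ and $\mu^+$. For probability measures $p,q$, $\mathrm{Ent}(p\,|\,q)=\int \rho\log\rho\,\mathrm{d}q$ if $p=\rho q$, and $+\infty$ otherwise. For $\varepsilon>0$, $v_\varepsilon \coloneqq \inf_{\gamma\in\Pi(\mu^-,\mu^+)}\{\int c\,\mathrm{d}\gamma + \varepsilon\,\mathrm{Ent}(\gamma\,|\,\mu^-\otimes\mu^+)\}$, and $v_0\coloneqq \inf_{\gamma\in\Pi(\mu^-,\mu^+)}\int c\,\mathrm{d}\gamma$. *)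

theory Defs
  imports "HOL-Probability.Probability"
begin

definition measure_support :: "'a::metric_space measure \<Rightarrow> 'a set" where
  "measure_support \<mu> = {x. \<forall>e>0. emeasure \<mu> (ball x e) > 0}"

definition couplings :: "'a measure \<Rightarrow> 'b measure \<Rightarrow> ('a \<times> 'b) measure set" where
  "couplings \<mu> \<nu> = {\<gamma>. prob_space \<gamma> \<and> sets \<gamma> = sets (\<mu> \<Otimes>\<^sub>M \<nu>)
      \<and> distr \<gamma> \<mu> fst = \<mu> \<and> distr \<gamma> \<nu> snd = \<nu>}"

text \<open>Relative entropy Ent(p | q) = integral of rho log rho dq if p = rho q, and +infinity otherwise
  (convention 0 log 0 = 0; the negative part of rho log rho is bounded, so a non-integrable
  integrand means the integral is +infinity).\<close>
definition rel_entropy :: "'a measure \<Rightarrow> 'a measure \<Rightarrow> ereal" where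
  "rel_entropy p q =
     (if sets p = sets q \<and> absolutely_continuous q p then
        (let \<rho> = (\<lambda>x. enn2real (RN_deriv q p x));
             g = (\<lambda>x. if \<rho> x = 0 then 0 else \<rho> x * ln (\<rho> x))
         in if integrable q g then ereal (\<integral>x. g x \<partial>q) else \<infinity>)
      else \<infinity>)"

text \<open>Entropic optimal transport value v_eps (with v_0 the unregularized value).
  The cost c is integrated over X x Y, where every coupling is concentrated.\<close>
definition ot_value :: "'a measure \<Rightarrow> 'b measure \<Rightarrow> 'a set \<Rightarrow> 'b set \<Rightarrow> ('a \<times> 'b \<Rightarrow> real)
    \<Rightarrow> real \<Rightarrow> ereal" where
  "ot_value \<mu> \<nu> X Y c \<epsilon> =
     (INF \<gamma>\<in>couplings \<mu> \<nu>. ereal (set_lebesgue_integral \<gamma> (X \<times> Y) c)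
        + (if \<epsilon> = 0 then 0 else ereal \<epsilon> * rel_entropy \<gamma> (\<mu> \<Otimes>\<^sub>M \<nu>)))"

definition real_analytic_on :: "(real \<Rightarrow> real) \<Rightarrow> real set \<Rightarrow> bool" where
  "real_analytic_on f S \<longleftrightarrow>
     (\<forall>x\<in>S. \<exists>r>0. \<exists>a::nat \<Rightarrow> real. \<forall>y. \<bar>y - x\<bar> < r \<longrightarrow> (\<lambda>n. a n * (y - x) ^ n) sums f y)"

end

(* For eps = 1/t the value is eps times the dual value of the Schroedinger system with kernel
   exp(-t c).  In logarithmic coordinates the Sinkhorn map contracts the oscillation seminorm by a
   uniform factor, because all Gibbs weights exp(phi(x) - t c(x,y)) are comparable up to a constant
   (Doeblin minorisation).  A mean value argument shows that the contraction survives when t becomes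
   complex with small imaginary part, so the iterates, which are holomorphic in t, converge uniformly
   and the dual value is holomorphic near the positive half-line; this gives analyticity.
   Monotonicity and concavity hold because the value is an infimum of affine functions of eps with
   nonnegative slope.  Continuity at 0 follows from the dual potentials f, g, which satisfy
   f(x) + g(y) <= t c(x,y) + t o(1) + O(1) on the product of the supports. *)
theory Submission
  imports Defs "HOL-Complex_Analysis.Complex_Analysis"
begin

text \<open>The principal logarithm of a complex integral is usable only while the integral stays
  off the negative axis, and phases could accumulate under iteration. The complex part is therefore
  built around a class of potentials with small imaginary oscillation that a Sinkhorn half-step
  preserves: imaginary parts are bounded by the distance to the half-step of the real data
  \<open>Re t\<close>, \<open>Re \<phi>\<close>, and the contraction estimate itself controls this
  distance. The contraction rate and the width of the complex domain deteriorate as the bound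
  \<open>R\<close> on the real inverse temperature grows, so \<open>R\<close> is a parameter, chosen
  anew for each \<epsilon> > 0. A contraction of oscillations sees functions only up to constants,
  hence the iterates are pinned to 0 at a base point. Estimates are pointwise on the whole type;
  extending the cost by 0 off the product of the supports allows this. At \<epsilon> = 0 couplings
  of infinite entropy become competitors; a pointwise bound on the dual potentials can be integrated
  against all of them, so no coupling has to be approximated by one of finite entropy.\<close>

section \<open>Holomorphic dependence of integrals on a parameter\<close>

lemma (in prob_space) bounded_integral:
  fixes f :: "'a \<Rightarrow> 'b::{banach, second_countable_topology}"
  assumes "f \<in> borel_measurable M" and "\<And>x. norm (f x) \<le> B"
  shows bounded_integrable: "integrable M f"
    and bounded_integral_norm_le: "norm (\<integral>x. f x \<partial>M) \<le> B"
proof -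
  show i: "integrable M f"
    by (rule integrable_const_bound[where B = B]) (use assms in auto)
  have "norm (\<integral>x. f x \<partial>M) \<le> (\<integral>x. norm (f x) \<partial>M)" by simp
  also have "\<dots> \<le> (\<integral>x. B \<partial>M)"
    by (rule integral_mono) (use assms i in auto)
  finally show "norm (\<integral>x. f x \<partial>M) \<le> B" by (simp add: prob_space)
qed

text \<open>Only \<open>f\<close> itself is assumed bounded: Cauchy's estimate turns
  \<open>B\<close> into a bound \<open>B / r\<close> for the derivative on a smaller disc, the mean
  value inequality then bounds all difference quotients by the same constant, and dominated
  convergence applies along every sequence. Measurability of \<open>f' z\<close> also comes out of
  this limit.\<close>

lemma (in prob_space) has_field_derivative_integral:
  fixes f f' :: "complex \<Rightarrow> 'a \<Rightarrow> complex"
  assumes S: "open S" "z \<in> S"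
    and df: "\<And>w x. w \<in> S \<Longrightarrow> ((\<lambda>w. f w x) has_field_derivative f' w x) (at w)"
    and meas: "\<And>w. w \<in> S \<Longrightarrow> f w \<in> borel_measurable M"
    and bound: "\<And>w x. w \<in> S \<Longrightarrow> norm (f w x) \<le> B"
  shows "((\<lambda>w. \<integral>x. f w x \<partial>M) has_field_derivative (\<integral>x. f' z x \<partial>M)) (at z)"
proof -
  obtain e where "e > 0" and e: "cball z e \<subseteq> S" using S open_contains_cball by blast
  \<comment> \<open>Half the radius leaves room for a disc of radius \<open>r\<close>, on which
    Cauchy's estimate is applied, around every point of \<open>cball z r\<close>.\<close>
  define r where "r = e / 2"
  have r: "r > 0" using \<open>e > 0\<close> by (simp add: r_def)
  have sub: "cball w r \<subseteq> S" if "w \<in> cball z r" for w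
  proof
    fix v assume "v \<in> cball w r"
    then have "dist z v \<le> e" using that dist_triangle[of z v w] by (simp add: r_def)
    then show "v \<in> S" using e by auto
  qed
  have f'_bound: "norm (f' w x) \<le> B / r" if "w \<in> cball z r" for w x
  proof -
    have hol: "(\<lambda>w. f w x) holomorphic_on S"
      using df S by (auto simp: holomorphic_on_open)
    have w: "w \<in> S" using sub[OF that] r by auto
    have "norm ((deriv ^^ 1) (\<lambda>w. f w x) w) \<le> fact 1 * B / r ^ 1"
    proof (rule Cauchy_inequality)
      show "(\<lambda>w. f w x) holomorphic_on ball w r"
        using hol sub[OF that] by (meson ball_subset_cball holomorphic_on_subset)
      show "continuous_on (cball w r) (\<lambda>w. f w x)"
        using hol sub[OF that] holomorphic_on_imp_continuous_on holomorphic_on_subset by blast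
      show "norm (f v x) \<le> B" if "norm (w - v) = r" for v
        using sub[OF \<open>w \<in> cball z r\<close>] that by (intro bound) (auto simp: dist_norm)
    qed (use r in auto)
    then show ?thesis using DERIV_imp_deriv[OF df[OF w]] by simp
  qed
  have lip: "norm (f w x - f z x) \<le> B / r * norm (w - z)" if "w \<in> cball z r" for w x
  proof (rule field_differentiable_bound[where S = "cball z r"])
    show "((\<lambda>w. f w x) has_field_derivative f' v x) (at v within cball z r)" if "v \<in> cball z r" for v
      by (rule has_field_derivative_at_within[OF df]) (use sub[of z] r that in auto)
    show "norm (f' v x) \<le> B / r" if "v \<in> cball z r" for v using f'_bound[OF that] .
    show "w \<in> cball z r" by fact
    show "z \<in> cball z r" using r by simp
  qed simp
  show ?thesis
    unfolding has_field_derivative_iff tendsto_at_iff_sequentially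
  proof (intro allI impI)
    fix X :: "nat \<Rightarrow> complex"
    assume Xz: "\<forall>i. X i \<in> UNIV - {z}" and X: "X \<longlonglongrightarrow> z"
    obtain N where N: "\<And>i. i \<ge> N \<Longrightarrow> dist (X i) z < r"
      using X r unfolding lim_sequentially by blast
    define Y where "Y = (\<lambda>i. X (i + N))"
    have Y: "Y i \<in> cball z r" "Y i \<noteq> z" "Y i \<in> S" for i
      using N[of "i + N"] Xz sub[of z] r by (auto simp: Y_def dist_commute less_imp_le)
    have Yz: "Y \<longlonglongrightarrow> z" unfolding Y_def using X by (rule LIMSEQ_ignore_initial_segment)
    define q where "q = (\<lambda>i x. (f (Y i) x - f z x) / (Y i - z))"
    have q_meas: "q i \<in> borel_measurable M" for i
      unfolding q_def using meas[OF Y(3)] meas[OF S(2)] by measurable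
    have lim: "(\<lambda>i. q i x) \<longlonglongrightarrow> f' z x" for x
    proof -
      have "((\<lambda>y. (f y x - f z x) / (y - z)) \<longlongrightarrow> f' z x) (at z)"
        using df[OF S(2)] by (simp add: has_field_derivative_iff)
      from this[unfolded tendsto_at_iff_sequentially, rule_format, of Y]
      show ?thesis using Y Yz by (auto simp: q_def o_def)
    qed
    have qb: "norm (q i x) \<le> B / r" for i x
      using lip[OF Y(1), of i x] Y(2)[of i]
      by (auto simp: q_def norm_divide divide_simps)
    have "(\<lambda>i. \<integral>x. q i x \<partial>M) \<longlonglongrightarrow> (\<integral>x. f' z x \<partial>M)"
    proof (rule integral_dominated_convergence[where w = "\<lambda>_. B / r"])
      show "f' z \<in> borel_measurable M"
        by (rule borel_measurable_LIMSEQ_metric[OF q_meas lim])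
    qed (use q_meas lim qb in auto)
    moreover have "(\<integral>x. q i x \<partial>M) = ((\<integral>x. f (Y i) x \<partial>M) - (\<integral>x. f z x \<partial>M)) / (Y i - z)" for i
      unfolding q_def using bounded_integrable[OF meas bound] Y S by simp
    ultimately have "(\<lambda>i. ((\<integral>x. f (X (i + N)) x \<partial>M) - (\<integral>x. f z x \<partial>M)) / (X (i + N) - z))
        \<longlonglongrightarrow> (\<integral>x. f' z x \<partial>M)"
      by (simp add: Y_def)
    from LIMSEQ_offset[OF this]
    show "((\<lambda>y. ((\<integral>x. f y x \<partial>M) - (\<integral>x. f z x \<partial>M)) / (y - z)) \<circ> X) \<longlonglongrightarrow> (\<integral>x. f' z x \<partial>M)"
      by (simp add: o_def)
  qed
qed

lemma (in prob_space) holomorphic_on_integral: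
  fixes f :: "complex \<Rightarrow> 'a \<Rightarrow> complex"
  assumes S: "open S"
    and hol: "\<And>x. (\<lambda>w. f w x) holomorphic_on S"
    and meas: "\<And>w. w \<in> S \<Longrightarrow> f w \<in> borel_measurable M"
    and bound: "\<And>w x. w \<in> S \<Longrightarrow> norm (f w x) \<le> B"
  shows "(\<lambda>w. \<integral>x. f w x \<partial>M) holomorphic_on S"
proof -
  have "((\<lambda>w. f w x) has_field_derivative deriv (\<lambda>w. f w x) w) (at w)" if "w \<in> S" for w x
    using hol[of x] S that holomorphic_derivI by blast
  then have "((\<lambda>w. \<integral>x. f w x \<partial>M) has_field_derivative (\<integral>x. deriv (\<lambda>w. f w x) z \<partial>M)) (at z)"
    if "z \<in> S" for z
    by (intro has_field_derivative_integral[OF S that, where B = B]) (use meas bound in auto)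
  then show ?thesis using S by (auto simp: holomorphic_on_open)
qed

text \<open>The error is relative to the weight \<open>exp (Re z)\<close>, since |exp(iy) - 1| \<le>
  |y|. Integrated against Gibbs weights it thus costs only a factor \<theta>, however large the
  exponents are.\<close>

lemma norm_exp_minus_exp_Re_le:
  assumes "\<bar>Im z\<bar> \<le> \<theta>"
  shows "norm (exp z - of_real (exp (Re z))) \<le> \<theta> * exp (Re z)"
proof -
  have "exp z = of_real (exp (Re z)) * exp (\<i> * Im z)"
    by (metis exp_eq_polar cis_conv_exp)
  then have "exp z - of_real (exp (Re z)) = of_real (exp (Re z)) * (exp (\<i> * Im z) - 1)"
    by (metis mult.right_neutral right_diff_distrib)
  moreover have "norm (exp (\<i> * Im z) - 1) \<le> \<bar>Im z\<bar>"
    using iexp_approx1[of "Im z" 0] by simp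
  ultimately show ?thesis using assms
    by (simp add: norm_mult mult.commute mult_left_mono)
qed

lemma (in prob_space) weighted_integral_norm_le:
  fixes f :: "'a \<Rightarrow> complex"
  assumes "f \<in> borel_measurable M" and "integrable M w" and "\<And>x. norm (f x) \<le> K * w x"
  shows "norm (\<integral>x. f x \<partial>M) \<le> K * (\<integral>x. w x \<partial>M)"
proof -
  have "norm (\<integral>x. f x \<partial>M) \<le> (\<integral>x. norm (f x) \<partial>M)" by simp
  also have "\<dots> \<le> (\<integral>x. K * w x \<partial>M)"
  proof (rule integral_mono)
    have "integrable M f"
      by (rule Bochner_Integration.integrable_bound[OF integrable_mult_right[OF assms(2), of K]])
         (use assms(1) order_trans[OF assms(3) abs_ge_self] in auto)
    then show "integrable M (\<lambda>x. norm (f x))" by simp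
  qed (use assms in auto)
  finally show ?thesis by simp
qed

section \<open>Averages against complex Gibbs weights\<close>

text \<open>The complex total mass differs from the positive number \<open>W\<close> by at most
  \<open>\<theta> * W\<close>. So \<theta> \<le> 1/2 confines it to the half-plane of real part at
  least \<open>W / 2\<close>, where division by it and the principal logarithm are safe.
  \<open>B\<close> secures integrability and positivity of \<open>W\<close>; the bounds on averages
  below are free of it.\<close>

locale complex_weight = prob_space +
  fixes g :: "'a \<Rightarrow> complex" and \<theta> B :: real
  assumes g_meas [measurable]: "g \<in> borel_measurable M"
    and g_bound: "norm (g x) \<le> B"
    and Im_g: "\<bar>Im (g x)\<bar> \<le> \<theta>"
    and theta_le: "\<theta> \<le> 1 / 2"
begin

definition "W = (\<integral>x. exp (Re (g x)) \<partial>M)"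

lemma theta_nonneg: "0 \<le> \<theta>"
  using Im_g[of undefined] abs_ge_zero order_trans by blast

lemma Re_g_bounds: "Re (g x) \<le> B" "- B \<le> Re (g x)"
  using g_bound[of x] abs_Re_le_cmod[of "g x"] by linarith+

lemma weight_integrable: "integrable M (\<lambda>x. exp (Re (g x)))"
  by (rule bounded_integrable[where B = "exp B"]) (use Re_g_bounds in auto)

lemma exp_g_integrable: "integrable M (\<lambda>x. exp (g x))"
  by (rule bounded_integrable[where B = "exp B"]) (use Re_g_bounds in auto)

lemma times_exp_integrable:
  fixes h :: "'a \<Rightarrow> complex"
  assumes [measurable]: "h \<in> borel_measurable M" and "\<And>x. norm (h x) \<le> b"
  shows "integrable M (\<lambda>x. h x * exp (g x))"
    and "integrable M (\<lambda>x. h x * exp (Re (g x)))"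
proof -
  have "0 \<le> b" using assms(2) norm_ge_zero order_trans by blast
  then have "norm (h x * exp (g x)) \<le> b * exp B"
    "norm (h x * exp (Re (g x))) \<le> b * exp B" for x
    using Re_g_bounds assms(2)[of x] by (auto simp: norm_mult intro!: mult_mono)
  then show "integrable M (\<lambda>x. h x * exp (g x))" "integrable M (\<lambda>x. h x * exp (Re (g x)))"
    by (auto intro!: bounded_integrable[where B = "b * exp B"])
qed

lemma W_ge: "exp (- B) \<le> W"
proof -
  have "(\<integral>x. exp (- B) \<partial>M) \<le> W"
    unfolding W_def by (rule integral_mono) (use weight_integrable Re_g_bounds in auto)
  then show ?thesis by (simp add: prob_space)
qed

lemma W_pos: "0 < W"
  using W_ge exp_gt_zero[of "- B"] by linarith

lemma times_exp_perturb:
  fixes h :: "'a \<Rightarrow> complex"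
  assumes [measurable]: "h \<in> borel_measurable M" and h: "\<And>x. norm (h x) \<le> b"
  shows "norm ((\<integral>x. h x * exp (g x) \<partial>M) - (\<integral>x. h x * exp (Re (g x)) \<partial>M)) \<le> b * \<theta> * W"
proof -
  have b: "0 \<le> b" using h norm_ge_zero order_trans by blast
  have "(\<integral>x. h x * exp (g x) \<partial>M) - (\<integral>x. h x * exp (Re (g x)) \<partial>M)
    = (\<integral>x. h x * (exp (g x) - exp (Re (g x))) \<partial>M)"
    using times_exp_integrable[OF assms] by (simp add: algebra_simps)
  also have "norm \<dots> \<le> (b * \<theta>) * (\<integral>x. exp (Re (g x)) \<partial>M)"
  proof (rule weighted_integral_norm_le[OF _ weight_integrable])
    fix x
    have "norm (h x * (exp (g x) - exp (Re (g x)))) \<le> b * (\<theta> * exp (Re (g x)))"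
      unfolding norm_mult using h b norm_exp_minus_exp_Re_le[OF Im_g] theta_nonneg
      by (intro mult_mono) (auto simp: exp_of_real)
    then show "norm (h x * (exp (g x) - exp (Re (g x)))) \<le> b * \<theta> * exp (Re (g x))"
      by (simp add: mult.assoc)
  qed auto
  finally show ?thesis by (simp add: W_def)
qed

lemma exp_integral_near: "norm ((\<integral>x. exp (g x) \<partial>M) - W) \<le> \<theta> * W"
  using times_exp_perturb[of "\<lambda>_. 1" 1]
  by (simp add: W_def exp_of_real flip: integral_complex_of_real)

lemma Re_exp_integral: "W / 2 \<le> Re (\<integral>x. exp (g x) \<partial>M)"
proof -
  have "\<theta> * W \<le> (1 / 2) * W" using theta_le W_pos by (intro mult_right_mono) auto
  then have "norm ((\<integral>x. exp (g x) \<partial>M) - W) \<le> W / 2" using exp_integral_near by simp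
  then show ?thesis using abs_Re_le_cmod[of "(\<integral>x. exp (g x) \<partial>M) - W"] by simp
qed

lemma norm_exp_integral: "W / 2 \<le> norm (\<integral>x. exp (g x) \<partial>M)"
  using Re_exp_integral complex_Re_le_cmod order_trans by blast

lemma exp_integral_not_nonpos: "(\<integral>x. exp (g x) \<partial>M) \<notin> \<real>\<^sub>\<le>\<^sub>0"
  using Re_exp_integral W_pos by (auto simp: complex_nonpos_Reals_iff)

text \<open>The numerator is at most \<open>b * W\<close>, the denominator at least
  \<open>W / 2\<close>. Complex averaging may thus double the sup norm, so this bound serves for
  small error terms and cannot replace the contraction.\<close>

lemma mean_norm_le:
  fixes h :: "'a \<Rightarrow> complex"
  assumes [measurable]: "h \<in> borel_measurable M" and h: "\<And>x. norm (h x) \<le> b"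
  shows "norm ((\<integral>x. h x * exp (g x) \<partial>M) / (\<integral>x. exp (g x) \<partial>M)) \<le> 2 * b"
proof -
  have b: "0 \<le> b" using h norm_ge_zero order_trans by blast
  have "norm (\<integral>x. h x * exp (g x) \<partial>M) \<le> b * W"
    unfolding W_def
    by (rule weighted_integral_norm_le[OF _ weight_integrable]) (use h in \<open>auto simp: norm_mult\<close>)
  also have "\<dots> \<le> 2 * b * norm (\<integral>x. exp (g x) \<partial>M)"
    using mult_left_mono[OF norm_exp_integral b] by simp
  finally show ?thesis
    using norm_exp_integral W_pos b by (simp add: norm_divide divide_simps split: if_splits)
qed

text \<open>Numerator and denominator each carry a relative error \<theta>; the lower bound
  \<open>W / 2\<close> for the complex denominator doubles their sum to 4 \<theta>.\<close>

lemma mean_perturb: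
  fixes h :: "'a \<Rightarrow> complex"
  assumes [measurable]: "h \<in> borel_measurable M" and h: "\<And>x. norm (h x) \<le> b"
  shows "norm ((\<integral>x. h x * exp (g x) \<partial>M) / (\<integral>x. exp (g x) \<partial>M)
    - (\<integral>x. h x * exp (Re (g x)) \<partial>M) / W) \<le> 4 * \<theta> * b"
proof -
  define E H H' where "E = (\<integral>x. exp (g x) \<partial>M)" and "H = (\<integral>x. h x * exp (g x) \<partial>M)"
    and "H' = (\<integral>x. h x * exp (Re (g x)) \<partial>M)"
  have b: "0 \<le> b" using h norm_ge_zero order_trans by blast
  have "E \<noteq> 0" using norm_exp_integral W_pos by (auto simp: E_def)
  have eq: "H / E - H' / W = ((H - H') * W + H' * (W - E)) / (E * W)"
    using \<open>E \<noteq> 0\<close> W_pos by (simp add: field_simps)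
  have H': "norm H' \<le> b * W"
    unfolding W_def H'_def
    by (rule weighted_integral_norm_le[OF _ weight_integrable])
       (use h in \<open>auto simp: norm_mult simp flip: exp_of_real\<close>)
  have "norm ((H - H') * W + H' * (W - E)) \<le> norm (H - H') * W + norm H' * norm (W - E)"
    using W_pos by (intro norm_triangle_le) (simp add: norm_mult)
  also have "\<dots> \<le> (b * \<theta> * W) * W + (b * W) * (\<theta> * W)"
    using times_exp_perturb[OF assms] exp_integral_near H' W_pos b theta_nonneg
    by (intro add_mono mult_mono) (auto simp: H_def H'_def E_def norm_minus_commute)
  also have "\<dots> = (4 * \<theta> * b) * (W / 2 * W)" by simp
  also have "\<dots> \<le> (4 * \<theta> * b) * (norm E * W)"
    using norm_exp_integral W_pos b theta_nonneg
    by (intro mult_left_mono mult_right_mono) (auto simp: E_def)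
  finally have "norm (H / E - H' / W) \<le> 4 * \<theta> * b"
    unfolding eq using \<open>E \<noteq> 0\<close> W_pos by (simp add: norm_divide norm_mult divide_simps mult_ac)
  then show ?thesis by (simp add: E_def H_def H'_def)
qed

end

text \<open>The two real Gibbs densities are comparable up to the factor \<open>exp (- 2 * a)\<close>, so their difference
  only involves the remaining fraction of the mass; the complex phases cost \<open>8 * \<theta>\<close>.\<close>
lemma mean_difference_bound:
  fixes h :: "'a \<Rightarrow> complex"
  assumes "complex_weight M g \<theta> B" and "complex_weight M g' \<theta> B"
    and near: "\<And>x. \<bar>Re (g x) - Re (g' x)\<bar> \<le> a"
    and [measurable]: "h \<in> borel_measurable M"
    and osc: "\<And>x x'. norm (h x - h x') \<le> b"
  shows "norm ((\<integral>x. h x * exp (g x) \<partial>M) / (\<integral>x. exp (g x) \<partial>M)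
    - (\<integral>x. h x * exp (g' x) \<partial>M) / (\<integral>x. exp (g' x) \<partial>M)) \<le> (1 - exp (- 2 * a) + 8 * \<theta>) * b"
proof -
  interpret p: complex_weight M g \<theta> B by fact
  interpret q: complex_weight M g' \<theta> B by fact
  define d where "d = exp (- 2 * a)"
  have b: "0 \<le> b" using osc[of undefined undefined] by simp
  have hb: "norm (h x) \<le> norm (h undefined) + b" for x
    using osc[of x undefined] norm_triangle_ineq2[of "h x" "h undefined"] by linarith
  \<comment> \<open>Subtracting a constant from \<open>h\<close> leaves the difference of the two
    averages unchanged. With the real \<open>g'\<close>-average as constant, \<open>k\<close> has
    mean zero for the second real density, and its norm is at most \<open>b\<close> because
    \<open>m\<close> is an average of values of \<open>h\<close>.\<close>
  define m where "m = (\<integral>x. h x * exp (Re (g' x)) \<partial>M) / q.W"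
  define k where "k = (\<lambda>x. h x - m)"
  have [measurable]: "k \<in> borel_measurable M" by (simp add: k_def)
  have kb: "norm (k x) \<le> b" for x
  proof -
    have "k x * q.W = (\<integral>y. (h x - h y) * exp (Re (g' y)) \<partial>M)"
      using q.times_exp_integrable[of h, OF _ hb] q.weight_integrable q.W_pos
      by (simp add: k_def m_def q.W_def left_diff_distrib field_simps flip: of_real_exp)
    also have "norm \<dots> \<le> b * q.W"
      unfolding q.W_def
      by (rule p.weighted_integral_norm_le[OF _ q.weight_integrable])
         (use osc in \<open>auto simp: norm_mult simp flip: exp_of_real\<close>)
    finally show ?thesis using q.W_pos by (simp add: norm_mult)
  qed
  have shift: "(\<integral>x. k x * exp (G x) \<partial>M) / (\<integral>x. exp (G x) \<partial>M)
      = (\<integral>x. h x * exp (G x) \<partial>M) / (\<integral>x. exp (G x) \<partial>M) - m"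
    if "complex_weight M G \<theta> B" for G
  proof -
    interpret G: complex_weight M G \<theta> B by fact
    have "(\<integral>x. exp (G x) \<partial>M) \<noteq> 0" using G.norm_exp_integral G.W_pos by auto
    then show ?thesis
      using G.times_exp_integrable[of h, OF _ hb] G.exp_g_integrable
      by (simp add: k_def left_diff_distrib diff_divide_distrib)
  qed
  have q0: "(\<integral>x. k x * exp (Re (g' x)) \<partial>M) = 0"
    using q.times_exp_integrable[of h, OF _ hb] q.weight_integrable q.W_pos
    by (simp add: k_def m_def left_diff_distrib q.W_def flip: of_real_exp)
  have e_cmp: "exp (- a) * exp (Re (g' x)) \<le> exp (Re (g x))"
    "exp (Re (g x)) \<le> exp a * exp (Re (g' x))" for x
    using near[of x] by (auto simp flip: exp_add)
  have W_cmp: "exp (- a) * q.W \<le> p.W" "p.W \<le> exp a * q.W"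
  proof -
    have "(\<integral>x. exp (- a) * exp (Re (g' x)) \<partial>M) \<le> (\<integral>x. exp (Re (g x)) \<partial>M)"
      by (intro integral_mono integrable_mult_right p.weight_integrable q.weight_integrable e_cmp)
    then show "exp (- a) * q.W \<le> p.W" by (simp add: q.W_def p.W_def)
    have "(\<integral>x. exp (Re (g x)) \<partial>M) \<le> (\<integral>x. exp a * exp (Re (g' x)) \<partial>M)"
      by (intro integral_mono integrable_mult_right p.weight_integrable q.weight_integrable e_cmp)
    then show "p.W \<le> exp a * q.W" by (simp add: q.W_def p.W_def)
  qed
  \<comment> \<open>What remains of the first density after removing the fraction \<open>d\<close>
    of the second. Its nonnegativity uses one factor exp(-a) for the weights and one for their
    totals, whence \<open>d = exp (- 2 * a)\<close>. The removal is free, as \<open>k\<close> has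
    mean zero against the second density, and mass \<open>1 - d\<close> is left.\<close>
  define w where "w = (\<lambda>x. exp (Re (g x)) / p.W - d * exp (Re (g' x)) / q.W)"
  have w_nonneg: "0 \<le> w x" for x
  proof -
    have "d * exp (Re (g' x)) * p.W \<le> d * exp (Re (g' x)) * (exp a * q.W)"
      using W_cmp by (intro mult_left_mono) (auto simp: d_def)
    also have "\<dots> = exp (Re (g' x) - a) * q.W"
      by (simp add: d_def flip: exp_add mult.assoc) 
    also have "\<dots> \<le> exp (Re (g x)) * q.W"
      using near[of x] q.W_pos by (intro mult_right_mono) auto
    finally show ?thesis
      using p.W_pos q.W_pos by (simp add: w_def divide_simps)
  qed
  have w_int: "integrable M w"
    unfolding w_def using p.weight_integrable q.weight_integrable by auto
  have w_tot: "(\<integral>x. w x \<partial>M) = 1 - d"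
    unfolding w_def using p.weight_integrable q.weight_integrable p.W_pos q.W_pos
    by (simp add: p.W_def q.W_def)
  have "(\<integral>x. k x * exp (Re (g x)) \<partial>M) / p.W
      = (\<integral>x. k x * exp (Re (g x)) \<partial>M) / p.W - d * (\<integral>x. k x * exp (Re (g' x)) \<partial>M) / q.W"
    by (simp add: q0)
  also have "\<dots> = (\<integral>x. k x * w x \<partial>M)"
  proof -
    have "k x * w x = k x * exp (Re (g x)) / p.W - d * (k x * exp (Re (g' x))) / q.W" for x
      by (simp add: w_def right_diff_distrib)
    then show ?thesis
      using p.times_exp_integrable(2)[of k, OF _ kb] q.times_exp_integrable(2)[of k, OF _ kb] by simp
  qed
  also have "norm \<dots> \<le> b * (\<integral>x. w x \<partial>M)"
    by (rule p.weighted_integral_norm_le[OF _ w_int])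
       (use kb w_nonneg w_int in \<open>auto simp: norm_mult intro!: mult_right_mono\<close>)
  finally have real: "norm ((\<integral>x. k x * exp (Re (g x)) \<partial>M) / p.W) \<le> (1 - d) * b"
    by (simp add: w_tot mult.commute)
  define P Q P' where "P = (\<integral>x. k x * exp (g x) \<partial>M) / (\<integral>x. exp (g x) \<partial>M)"
    and "Q = (\<integral>x. k x * exp (g' x) \<partial>M) / (\<integral>x. exp (g' x) \<partial>M)"
    and "P' = (\<integral>x. k x * exp (Re (g x)) \<partial>M) / p.W"
  \<comment> \<open>The real counterpart of \<open>Q\<close> is 0 by the choice of \<open>m\<close>,
    so \<open>Q\<close> is a pure phase error.\<close>
  have "norm (P - P') \<le> 4 * \<theta> * b" "norm Q \<le> 4 * \<theta> * b"
    using p.mean_perturb[of k, OF _ kb] q.mean_perturb[of k, OF _ kb] by (simp_all add: P_def P'_def Q_def q0)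
  moreover have "norm (P - Q) \<le> norm (P - P') + norm P' + norm Q"
    using norm_triangle_ineq4[of P Q] norm_triangle_sub[of P P'] by linarith
  ultimately have "norm (P - Q) \<le> (1 - d) * b + 8 * \<theta> * b"
    using real by (simp add: P'_def)
  moreover have "P - Q = (\<integral>x. h x * exp (g x) \<partial>M) / (\<integral>x. exp (g x) \<partial>M)
    - (\<integral>x. h x * exp (g' x) \<partial>M) / (\<integral>x. exp (g' x) \<partial>M)"
    unfolding P_def Q_def using shift assms(1,2) by simp
  ultimately show ?thesis by (simp add: d_def algebra_simps)
qed

section \<open>Mean value estimates for logarithms of Gibbs integrals\<close>

lemma Im_convex_combination:
  assumes "\<bar>Im z\<bar> \<le> \<theta>" "\<bar>Im (z + w)\<bar> \<le> \<theta>" "0 \<le> u" "u \<le> 1"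
  shows "\<bar>Im (z + of_real u * w)\<bar> \<le> \<theta>"
proof -
  have "Im (z + of_real u * w) = (1 - u) * Im z + u * Im (z + w)" by (simp add: algebra_simps)
  also have "\<bar>\<dots>\<bar> \<le> (1 - u) * \<bar>Im z\<bar> + u * \<bar>Im (z + w)\<bar>"
    using assms by (intro order_trans[OF abs_triangle_ineq]) (simp add: abs_mult)
  also have "\<dots> \<le> \<theta>" using assms by (intro convex_bound_le) auto
  finally show ?thesis .
qed

text \<open>The derivative of the logarithm of a Gibbs integral is the Gibbs average of the
  perturbation. This is how bounds on averages become bounds on potentials.\<close>

lemma Ln_exp_integral_has_derivative:
  fixes A D :: "'a \<Rightarrow> complex"
  assumes "prob_space M"
    and [measurable]: "A \<in> borel_measurable M" "D \<in> borel_measurable M"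
    and A: "\<And>x. norm (A x) \<le> B" and D: "\<And>x. norm (D x) \<le> B"
    and z: "norm z \<le> 1" and w: "complex_weight M (\<lambda>x. A x + z * D x) \<theta> B'"
  shows "((\<lambda>s. Ln (\<integral>x. exp (A x + s * D x) \<partial>M)) has_field_derivative
    (\<integral>x. D x * exp (A x + z * D x) \<partial>M) / (\<integral>x. exp (A x + z * D x) \<partial>M)) (at z)"
proof -
  interpret prob_space M by fact
  interpret w: complex_weight M "\<lambda>x. A x + z * D x" \<theta> B' by fact
  have "((\<lambda>s. \<integral>x. exp (A x + s * D x) \<partial>M) has_field_derivative
      (\<integral>x. D x * exp (A x + z * D x) \<partial>M)) (at z)"
  \<comment> \<open>An open neighbourhood of the closed unit disc on which the exponents have real
    part at most \<open>3 * B\<close>.\<close>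
  proof (rule has_field_derivative_integral[where S = "ball 0 2" and B = "exp (3 * B)"])
    fix s x
    assume s: "s \<in> ball (0 :: complex) 2"
    have "norm (s * D x) \<le> 2 * B" unfolding norm_mult using s D by (intro mult_mono) auto
    then have "Re (A x + s * D x) \<le> 3 * B"
      using A[of x] complex_Re_le_cmod[of "A x + s * D x"] norm_triangle_ineq[of "A x" "s * D x"]
      by linarith
    then show "norm (exp (A x + s * D x)) \<le> exp (3 * B)" by simp
    show "((\<lambda>s. exp (A x + s * D x)) has_field_derivative D x * exp (A x + s * D x)) (at s)"
      by (auto intro!: derivative_eq_intros)
  qed (use z in auto)
  from DERIV_chain2[OF has_field_derivative_Ln[OF w.exp_integral_not_nonpos] this]
  show ?thesis by (simp add: divide_inverse mult.commute)
qed

text \<open>Along \<open>A + s * D\<close>, 0 \<le> s \<le> 1, the difference of the two logarithms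
  has as derivative a difference of Gibbs averages. The common part \<open>h\<close> of
  \<open>D\<close> and \<open>D'\<close> is averaged with two comparable weights and contracts by
  \<open>mean_difference_bound\<close>; each remainder, of size \<open>e\<close>, costs 2 e by
  \<open>mean_norm_le\<close>. The bounds on real and imaginary parts are imposed at the endpoints
  because convex combinations preserve them.\<close>

lemma Ln_exp_integral_difference:
  fixes A A' D D' h :: "'a \<Rightarrow> complex"
  assumes "prob_space M"
    and [measurable]: "A \<in> borel_measurable M" "D \<in> borel_measurable M"
      "A' \<in> borel_measurable M" "D' \<in> borel_measurable M" "h \<in> borel_measurable M"
    and B: "\<And>x. norm (A x) \<le> B" "\<And>x. norm (D x) \<le> B" "\<And>x. norm (A' x) \<le> B" "\<And>x. norm (D' x) \<le> B"
    and Im: "\<And>x. \<bar>Im (A x)\<bar> \<le> \<theta>" "\<And>x. \<bar>Im (A x + D x)\<bar> \<le> \<theta>"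
      "\<And>x. \<bar>Im (A' x)\<bar> \<le> \<theta>" "\<And>x. \<bar>Im (A' x + D' x)\<bar> \<le> \<theta>"
    and th: "\<theta> \<le> 1 / 2"
    and Re: "\<And>x. \<bar>Re (A x) - Re (A' x)\<bar> \<le> a" "\<And>x. \<bar>Re (A x + D x) - Re (A' x + D' x)\<bar> \<le> a"
    and h: "\<And>x x'. norm (h x - h x') \<le> b"
    and D: "\<And>x. norm (D x - h x) \<le> e" "\<And>x. norm (D' x - h x) \<le> e"
  shows "norm ((Ln (\<integral>x. exp (A x + D x) \<partial>M) - Ln (\<integral>x. exp (A' x + D' x) \<partial>M))
      - (Ln (\<integral>x. exp (A x) \<partial>M) - Ln (\<integral>x. exp (A' x) \<partial>M)))
    \<le> (1 - exp (- 2 * a) + 8 * \<theta>) * b + 4 * e"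
proof -
  interpret prob_space M by fact
  define F where "F = (\<lambda>s. Ln (\<integral>x. exp (A x + s * D x) \<partial>M) - Ln (\<integral>x. exp (A' x + s * D' x) \<partial>M))"
  define m where "m = (\<lambda>A D (s::complex). (\<integral>x. D x * exp (A x + s * D x) \<partial>M) / (\<integral>x. exp (A x + s * D x) \<partial>M))"
  have seg: "\<exists>u. s = of_real u \<and> 0 \<le> u \<and> u \<le> 1" if "s \<in> closed_segment 0 (1::complex)" for s
    using that by (auto simp: in_segment scaleR_conv_of_real)
  have weight: "complex_weight M (\<lambda>x. A x + s * D x) \<theta> (2 * B)"
    if s: "s \<in> closed_segment 0 1" and [measurable]: "A \<in> borel_measurable M" "D \<in> borel_measurable M"
      and A: "\<And>x. norm (A x) \<le> B" and D: "\<And>x. norm (D x) \<le> B"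
      and I: "\<And>x. \<bar>Im (A x)\<bar> \<le> \<theta>" "\<And>x. \<bar>Im (A x + D x)\<bar> \<le> \<theta>"
    for s and A D :: "'a \<Rightarrow> complex"
  proof
    obtain u where u: "s = of_real u" "0 \<le> u" "u \<le> 1" using seg[OF s] by blast
    fix x
    have "norm (s * D x) \<le> 1 * B" unfolding norm_mult using u D by (intro mult_mono) auto
    then show "norm (A x + s * D x) \<le> 2 * B"
      using A[of x] norm_triangle_ineq[of "A x" "s * D x"] by linarith
    show "\<bar>Im (A x + s * D x)\<bar> \<le> \<theta>"
      unfolding u(1) using I u by (intro Im_convex_combination) auto
  qed (use th in auto)
  have "norm (F 1 - F 0) \<le> ((1 - exp (- 2 * a) + 8 * \<theta>) * b + 4 * e) * norm (1 - 0 :: complex)"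
  proof (rule field_differentiable_bound[where S = "closed_segment 0 1" and f' = "\<lambda>s. m A D s - m A' D' s"])
    fix s :: complex
    assume s: "s \<in> closed_segment 0 1"
    obtain u where u: "s = of_real u" "0 \<le> u" "u \<le> 1" using seg[OF s] by blast
    have ns: "norm s \<le> 1" using u by simp
    have w: "complex_weight M (\<lambda>x. A x + s * D x) \<theta> (2 * B)"
      "complex_weight M (\<lambda>x. A' x + s * D' x) \<theta> (2 * B)"
      using weight[OF s] B Im by simp_all
    interpret w: complex_weight M "\<lambda>x. A x + s * D x" \<theta> "2 * B" by (rule w)
    interpret w': complex_weight M "\<lambda>x. A' x + s * D' x" \<theta> "2 * B" by (rule w)
    have "(F has_field_derivative m A D s - m A' D' s) (at s)"
      unfolding F_def m_def
      by (intro DERIV_diff Ln_exp_integral_has_derivative[where B = B and \<theta> = \<theta> and B' = "2 * B"])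
         (use assms(1-5) B w ns in auto)
    then show "(F has_field_derivative m A D s - m A' D' s) (at s within closed_segment 0 1)"
      by (rule has_field_derivative_at_within)
    define m1 m2 m3 m4 where
      "m1 = (\<integral>x. h x * exp (A x + s * D x) \<partial>M) / (\<integral>x. exp (A x + s * D x) \<partial>M)"
      and "m2 = (\<integral>x. h x * exp (A' x + s * D' x) \<partial>M) / (\<integral>x. exp (A' x + s * D' x) \<partial>M)"
      and "m3 = (\<integral>x. (D x - h x) * exp (A x + s * D x) \<partial>M) / (\<integral>x. exp (A x + s * D x) \<partial>M)"
      and "m4 = (\<integral>x. (D' x - h x) * exp (A' x + s * D' x) \<partial>M) / (\<integral>x. exp (A' x + s * D' x) \<partial>M)"
    have hb: "norm (h x) \<le> B + e" for x
      using B(2)[of x] D(1)[of x] norm_triangle_ineq3[of "h x" "D x"] by (simp add: norm_minus_commute)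
    have split: "m A D s = m1 + m3" "m A' D' s = m2 + m4"
      unfolding m_def m1_def m2_def m3_def m4_def
      using w.times_exp_integrable(1)[OF _ B(2)] w.times_exp_integrable(1)[OF _ hb]
        w'.times_exp_integrable(1)[OF _ B(4)] w'.times_exp_integrable(1)[OF _ hb]
      by (simp_all add: left_diff_distrib diff_divide_distrib)
    have near: "\<bar>Re (A x + s * D x) - Re (A' x + s * D' x)\<bar> \<le> a" for x
    proof -
      have "Re (A x + s * D x) - Re (A' x + s * D' x)
        = (1 - u) * (Re (A x) - Re (A' x)) + u * (Re (A x + D x) - Re (A' x + D' x))"
        by (simp add: u(1) algebra_simps)
      also have "\<bar>\<dots>\<bar> \<le> (1 - u) * \<bar>Re (A x) - Re (A' x)\<bar> + u * \<bar>Re (A x + D x) - Re (A' x + D' x)\<bar>"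
        using u by (intro order_trans[OF abs_triangle_ineq]) (simp add: abs_mult)
      also have "\<dots> \<le> a" using Re u by (intro convex_bound_le) auto
      finally show ?thesis .
    qed
    have "norm (m1 - m2) \<le> (1 - exp (- 2 * a) + 8 * \<theta>) * b"
      unfolding m1_def m2_def by (rule mean_difference_bound[OF w near _ h]) simp
    moreover have "norm m3 \<le> 2 * e" "norm m4 \<le> 2 * e"
      unfolding m3_def m4_def by (rule w.mean_norm_le w'.mean_norm_le; use D in simp)+
    moreover have "norm (m A D s - m A' D' s) \<le> norm (m1 - m2) + norm m3 + norm m4"
    proof -
      have "m A D s - m A' D' s = (m1 - m2) + m3 - m4" by (simp add: split)
      then show ?thesis
        using norm_triangle_ineq4[of "(m1 - m2) + m3" m4] norm_triangle_ineq[of "m1 - m2" m3] by simp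
    qed
    ultimately show "norm (m A D s - m A' D' s) \<le> (1 - exp (- 2 * a) + 8 * \<theta>) * b + 4 * e"
      by linarith
  qed auto
  then show ?thesis by (simp add: F_def)
qed

section \<open>The Sinkhorn iteration at complex inverse temperature\<close>

text \<open>\<open>R\<close> limits the real inverse temperature. It enters the constants of the
  iteration but not the definition of \<open>optval\<close>, so facts on \<open>optval\<close>
  obtained with different \<open>R\<close> can be combined.\<close>

locale cost_kernel = M: prob_space M + N: prob_space N
  for M :: "'a measure" and N :: "'b measure" +
  fixes c :: "'a \<Rightarrow> 'b \<Rightarrow> real" and C R :: real
  assumes space_M: "space M = UNIV" and space_N: "space N = UNIV"
    and c_meas: "(\<lambda>(x, y). c x y) \<in> borel_measurable (M \<Otimes>\<^sub>M N)"
    and c_bound: "\<bar>c x y\<bar> \<le> C"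
    and C_pos: "0 < C" and R_pos: "0 < R"
begin

text \<open>The two half-steps of the Sinkhorn map are one construction with the marginals
  exchanged; estimates are proved for one and transported along this symmetry.\<close>

lemma swap: "cost_kernel N M (\<lambda>y x. c x y) C R"
proof
  show "(\<lambda>(y, x). c x y) \<in> borel_measurable (N \<Otimes>\<^sub>M M)"
    using measurable_compose[OF measurable_pair_swap' c_meas] by (simp add: case_prod_unfold)
qed (use space_M space_N c_bound C_pos R_pos in auto)

lemma c_measurable1 [measurable]: "(\<lambda>x. c x y) \<in> borel_measurable M"
  using measurable_compose[OF measurable_Pair2'[of y N M] c_meas] space_N by simp

text \<open>The Doeblin constant. For |Re t| < R the real exponents belonging to two points
  \<open>y\<close>, \<open>y'\<close> differ by at most a = 2 R C, and
  \<open>mean_difference_bound\<close> provides the common fraction exp(-2a).\<close>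

definition \<delta> :: real where "\<delta> = exp (- (4 * R * C))"

definition \<Omega> :: "complex set" where
  "\<Omega> = {t. \<bar>Re t\<bar> < R \<and> \<bar>Im t\<bar> * C < \<delta>\<^sup>2 / 256}"

lemma delta_bounds: "0 < \<delta>" "\<delta> \<le> 1"
  using R_pos C_pos by (auto simp: \<delta>_def)

lemma open_Omega: "open \<Omega>"
  unfolding \<Omega>_def by (intro open_Collect_conj open_Collect_less continuous_intros)

lemma of_real_in_Omega: "\<bar>s\<bar> < R \<Longrightarrow> of_real s \<in> \<Omega>"
  using delta_bounds by (simp add: \<Omega>_def)

lemma Re_in_Omega: "t \<in> \<Omega> \<Longrightarrow> of_real (Re t) \<in> \<Omega>"
  using delta_bounds by (simp add: \<Omega>_def)

lemma zero_in_Omega: "0 \<in> \<Omega>"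
  using of_real_in_Omega[of 0] R_pos by simp

lemma delta_square_le: "\<delta>\<^sup>2 \<le> \<delta>"
  using delta_bounds by (simp add: power2_eq_square mult_left_le)

lemma Omega_norm: "t \<in> \<Omega> \<Longrightarrow> C * norm t \<le> C * R + 1"
proof -
  assume t: "t \<in> \<Omega>"
  have "C * norm t \<le> C * (\<bar>Re t\<bar> + \<bar>Im t\<bar>)"
    using cmod_le C_pos by (intro mult_left_mono) auto
  also have "\<dots> \<le> C * R + 1"
    using t C_pos delta_square_le delta_bounds
    by (intro order_trans[OF eq_refl[OF distrib_left] add_mono])
       (auto simp: \<Omega>_def mult.commute less_imp_le)
  finally show ?thesis .
qed

text \<open>The radii of \<open>\<Omega>\<close> and of the imaginary oscillation below make the class invariant:
  \<open>(1 - \<delta> / 2) * (\<delta> / 32) + 4 * (\<delta>\<^sup>2 / 256) = \<delta> / 32\<close>, where the second term bounds the effect of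
  replacing \<open>t\<close> by its real part.\<close>
definition admissible :: "('a \<Rightarrow> complex) \<Rightarrow> bool" where
  "admissible \<phi> \<longleftrightarrow> \<phi> \<in> borel_measurable M \<and> (\<exists>B. \<forall>x. norm (\<phi> x) \<le> B)
    \<and> (\<forall>x x'. \<bar>Im (\<phi> x) - Im (\<phi> x')\<bar> \<le> \<delta> / 32) \<and> (\<exists>x. Im (\<phi> x) = 0)"

lemma admissible_meas [measurable_dest]: "admissible \<phi> \<Longrightarrow> \<phi> \<in> borel_measurable M"
  by (simp add: admissible_def)

text \<open>A point of vanishing imaginary part turns the oscillation bound into a bound on the
  imaginary part itself.\<close>

lemma admissible_Im: "admissible \<phi> \<Longrightarrow> \<bar>Im (\<phi> x)\<bar> \<le> \<delta> / 32"
  unfolding admissible_def by (metis diff_zero)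

lemma admissible_zero: "admissible (\<lambda>_. 0)"
  using delta_bounds by (auto simp: admissible_def)

lemma admissible_Re:
  assumes "admissible \<phi>" shows "admissible (\<lambda>x. of_real (Re (\<phi> x)))"
proof -
  obtain B where B: "norm (\<phi> x) \<le> B" for x using assms by (auto simp: admissible_def)
  have "\<bar>Re (\<phi> x)\<bar> \<le> B" for x using abs_Re_le_cmod[of "\<phi> x"] B[of x] by linarith
  then show ?thesis using assms delta_bounds by (auto simp: admissible_def)
qed

text \<open>With \<theta> = \<delta>/16 the phase cost 8 \<theta> is \<delta>/2, half of the Doeblin
  gain \<delta>, which leaves the contraction factor 1 - \<delta>/2. The potential contributes
  \<delta>/32 to the bound and \<open>Im t\<close> at most \<delta>/256.\<close>

lemma Im_exponent:
  assumes "admissible \<phi>" "t \<in> \<Omega>"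
  shows "\<bar>Im (\<phi> x - t * c x y)\<bar> \<le> \<delta> / 16"
proof -
  have "\<bar>Im t * c x y\<bar> \<le> \<bar>Im t\<bar> * C"
    unfolding abs_mult using c_bound by (intro mult_left_mono) auto
  also have "\<dots> \<le> \<delta> / 256" using assms(2) delta_square_le by (simp add: \<Omega>_def)
  finally show ?thesis
    using admissible_Im[OF assms(1), of x] delta_bounds
      abs_triangle_ineq4[of "Im (\<phi> x)" "Im t * c x y"] by simp
qed

lemma norm_t_c:
  assumes "t \<in> \<Omega>" shows "norm (t * c x y) \<le> C * R + 1"
proof -
  have "norm (t * c x y) \<le> norm t * C"
    unfolding norm_mult using c_bound by (intro mult_left_mono) auto
  then show ?thesis using Omega_norm[OF assms] by (simp add: mult.commute)
qed

lemma weight: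
  assumes \<phi>: "admissible \<phi>" and B: "\<And>x. norm (\<phi> x) \<le> B" and t: "t \<in> \<Omega>"
  shows "complex_weight M (\<lambda>x. \<phi> x - t * c x y) (\<delta> / 16) (B + (C * R + 1))"
proof
  show "(\<lambda>x. \<phi> x - t * c x y) \<in> borel_measurable M" using \<phi> by measurable
  show "norm (\<phi> x - t * c x y) \<le> B + (C * R + 1)" for x
    using B[of x] norm_t_c[OF t, of x y] norm_triangle_ineq4[of "\<phi> x" "t * c x y"] by linarith
  show "\<bar>Im (\<phi> x - t * c x y)\<bar> \<le> \<delta> / 16" for x
    using Im_exponent[OF \<phi> t] .
qed (use delta_bounds in auto)

definition log_partition :: "complex \<Rightarrow> ('a \<Rightarrow> complex) \<Rightarrow> 'b \<Rightarrow> complex" where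
  "log_partition t \<phi> y = Ln (\<integral>x. exp (\<phi> x - t * c x y) \<partial>M)"

lemma exp_log_partition:
  assumes "admissible \<phi>" "t \<in> \<Omega>"
  shows "exp (log_partition t \<phi> y) = (\<integral>x. exp (\<phi> x - t * c x y) \<partial>M)"
proof -
  obtain B where B: "norm (\<phi> x) \<le> B" for x using assms by (auto simp: admissible_def)
  interpret w: complex_weight M "\<lambda>x. \<phi> x - t * c x y" "\<delta> / 16" "B + (C * R + 1)"
    using weight[OF assms(1) B assms(2)] .
  have "(\<integral>x. exp (\<phi> x - t * c x y) \<partial>M) \<noteq> 0" using w.exp_integral_not_nonpos by auto
  then show ?thesis by (simp add: log_partition_def)
qed

lemma log_partition_measurable:
  assumes "admissible \<phi>" shows "log_partition t \<phi> \<in> borel_measurable N"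
proof -
  have [measurable]: "\<phi> \<in> borel_measurable M" using assms by (simp add: admissible_def)
  have [measurable]: "(\<lambda>p. c (snd p) (fst p)) \<in> borel_measurable (N \<Otimes>\<^sub>M M)"
    using cost_kernel.c_meas[OF swap] by (simp add: case_prod_unfold)
  have "(\<lambda>y. \<integral>x. exp (\<phi> x - t * c x y) \<partial>M) \<in> borel_measurable N"
    by (rule M.borel_measurable_lebesgue_integral) (simp add: case_prod_unfold)
  from measurable_compose[OF this Ln_measurable] show ?thesis by (simp add: log_partition_def [abs_def])
qed

text \<open>One estimate serves three purposes: with \<open>t1 = t2\<close> it is the contraction;
  with equal potentials and \<open>t2 = 0\<close> it bounds a half-step; with the real parts as
  second data it controls imaginary parts. The two exponents are joined by a segment whose direction
  is \<phi>1 - \<phi>2 up to the error (t1 - t2) c.\<close>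

lemma log_partition_difference:
  assumes \<phi>: "admissible \<phi>1" "admissible \<phi>2" and t: "t1 \<in> \<Omega>" "t2 \<in> \<Omega>"
    and osc: "\<And>x x'. norm ((\<phi>1 x - \<phi>2 x) - (\<phi>1 x' - \<phi>2 x')) \<le> b"
  shows "norm ((log_partition t1 \<phi>1 y - log_partition t1 \<phi>1 y') - (log_partition t2 \<phi>2 y - log_partition t2 \<phi>2 y'))
    \<le> (1 - \<delta> / 2) * b + 4 * (norm (t1 - t2) * C)"
proof -
  note [measurable] = \<phi>[THEN admissible_meas]
  obtain B1 where B1: "norm (\<phi>1 x) \<le> B1" for x using \<phi> by (auto simp: admissible_def)
  obtain B2 where B2: "norm (\<phi>2 x) \<le> B2" for x using \<phi> by (auto simp: admissible_def)
  define A where "A = (\<lambda>y x. \<phi>2 x - t2 * c x y)"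
  define D where "D = (\<lambda>y x. (\<phi>1 x - \<phi>2 x) - (t1 - t2) * c x y)"
  define K where "K = B1 + B2 + 2 * (C * R + 1)"
  have AD: "A y x + D y x = \<phi>1 x - t1 * c x y" for y x
    by (simp add: A_def D_def algebra_simps)
  have A: "norm (A y x) \<le> B2 + (C * R + 1)" for x y
    using B2[of x] norm_t_c[OF t(2), of x y] norm_triangle_ineq4[of "\<phi>2 x" "t2 * c x y"]
    by (simp add: A_def)
  have AD_norm: "norm (A y x + D y x) \<le> B1 + (C * R + 1)" for x y
    using B1[of x] norm_t_c[OF t(1), of x y] norm_triangle_ineq4[of "\<phi>1 x" "t1 * c x y"]
    by (simp add: AD)
  have D: "norm (D y x) \<le> K" for x y
    using A[of y x] AD_norm[of y x] norm_triangle_ineq4[of "A y x + D y x" "A y x"]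
    by (simp add: K_def)
  have A': "norm (A y x) \<le> K" for x y
  proof -
    have "0 \<le> B1" using B1 norm_ge_zero order_trans by blast
    moreover have "0 \<le> C * R + 1" using mult_pos_pos[OF C_pos R_pos] by simp
    ultimately have "B2 + (C * R + 1) \<le> K" unfolding K_def by simp
    then show ?thesis by (rule order_trans[OF A])
  qed
  have near: "\<bar>Re (\<phi> - t * c x y) - Re (\<phi> - t * c x y')\<bar> \<le> 2 * R * C"
    if "t \<in> \<Omega>" for t \<phi> x
  proof -
    have "\<bar>Re t * (c x y' - c x y)\<bar> \<le> R * (2 * C)"
      unfolding abs_mult using that c_bound[of x y] c_bound[of x y']
      by (intro mult_mono) (auto simp: \<Omega>_def)
    then show ?thesis by (simp add: algebra_simps)
  qed
  have e: "norm ((t1 - t2) * c x y) \<le> norm (t1 - t2) * C" for x y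
    unfolding norm_mult using c_bound by (intro mult_left_mono) auto
  have "norm ((Ln (\<integral>x. exp (A y x + D y x) \<partial>M) - Ln (\<integral>x. exp (A y' x + D y' x) \<partial>M))
      - (Ln (\<integral>x. exp (A y x) \<partial>M) - Ln (\<integral>x. exp (A y' x) \<partial>M)))
    \<le> (1 - exp (- 2 * (2 * R * C)) + 8 * (\<delta> / 16)) * b + 4 * (norm (t1 - t2) * C)"
  proof (rule Ln_exp_integral_difference[where B = K and h = "\<lambda>x. \<phi>1 x - \<phi>2 x"])
    show "prob_space M" by (rule M.prob_space_axioms)
    show "\<bar>Im (A y x)\<bar> \<le> \<delta> / 16" "\<bar>Im (A y' x)\<bar> \<le> \<delta> / 16" for x
      unfolding A_def by (rule Im_exponent[OF \<phi>(2) t(2)])+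
    show "\<bar>Im (A y x + D y x)\<bar> \<le> \<delta> / 16" "\<bar>Im (A y' x + D y' x)\<bar> \<le> \<delta> / 16" for x
      unfolding AD by (rule Im_exponent[OF \<phi>(1) t(1)])+
    show "\<bar>Re (A y x) - Re (A y' x)\<bar> \<le> 2 * R * C" for x
      unfolding A_def by (rule near[OF t(2)])
    show "\<bar>Re (A y x + D y x) - Re (A y' x + D y' x)\<bar> \<le> 2 * R * C" for x
      unfolding AD by (rule near[OF t(1)])
    show "norm (D y x - (\<phi>1 x - \<phi>2 x)) \<le> norm (t1 - t2) * C"
      "norm (D y' x - (\<phi>1 x - \<phi>2 x)) \<le> norm (t1 - t2) * C" for x
      using e by (simp_all add: D_def)
    show "A y \<in> borel_measurable M" "D y \<in> borel_measurable M"
      "A y' \<in> borel_measurable M" "D y' \<in> borel_measurable M"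
      "(\<lambda>x. \<phi>1 x - \<phi>2 x) \<in> borel_measurable M"
      unfolding A_def D_def by measurable
  qed (use A' D osc delta_bounds in auto)
  moreover have "1 - exp (- 2 * (2 * R * C)) + 8 * (\<delta> / 16) = 1 - \<delta> / 2"
    by (simp add: \<delta>_def mult_ac)
  ultimately show ?thesis
    unfolding AD log_partition_def unfolding A_def by simp
qed

text \<open>Minus the log-partition function is the softened c-transform of \<phi>. The contraction
  controls only oscillations; pinning the value 0 at \<open>y0\<close> makes an oscillation bound a
  sup norm bound.\<close>

definition half_step :: "'b \<Rightarrow> complex \<Rightarrow> ('a \<Rightarrow> complex) \<Rightarrow> 'b \<Rightarrow> complex" where
  "half_step y0 t \<phi> y = log_partition t \<phi> y0 - log_partition t \<phi> y"

lemma half_step_at_base: "half_step y0 t \<phi> y0 = 0"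
  by (simp add: half_step_def)

lemma half_step_contract:
  assumes "admissible \<phi>1" "admissible \<phi>2" "t \<in> \<Omega>"
    and "\<And>x x'. norm ((\<phi>1 x - \<phi>2 x) - (\<phi>1 x' - \<phi>2 x')) \<le> b"
  shows "norm ((half_step y0 t \<phi>1 y - half_step y0 t \<phi>2 y) - (half_step y0 t \<phi>1 y' - half_step y0 t \<phi>2 y')) \<le> (1 - \<delta> / 2) * b"
  using log_partition_difference[OF assms(1,2,3,3,4), of y' y] by (simp add: half_step_def algebra_simps)

text \<open>The gain is given away on purpose: in a full Sinkhorn step one half contracts, and the
  other has only to be nonexpansive.\<close>

lemma half_step_osc:
  assumes "admissible \<phi>1" "admissible \<phi>2" "t \<in> \<Omega>"
    and osc: "\<And>x x'. norm ((\<phi>1 x - \<phi>2 x) - (\<phi>1 x' - \<phi>2 x')) \<le> b"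
  shows "norm ((half_step y0 t \<phi>1 y - half_step y0 t \<phi>2 y)
    - (half_step y0 t \<phi>1 y' - half_step y0 t \<phi>2 y')) \<le> b"
proof -
  have "0 \<le> b" using osc[of undefined undefined] by simp
  then have "(1 - \<delta> / 2) * b \<le> b" using delta_bounds by (simp add: mult_left_le_one_le)
  then show ?thesis using half_step_contract[OF assms] by (rule order_trans[rotated])
qed

text \<open>A bound for half-steps that does not depend on the potential they start from, so it
  holds along the whole iteration. The 4 is the coefficient of the \<open>t\<close>-error in
  \<open>log_partition_difference\<close>, and \<open>C * R + 1\<close> bounds
  \<open>C * norm t\<close> on \<Omega>.\<close>

definition K :: real where "K = 4 * (C * R + 1)"

lemma half_step_norm:
  assumes "admissible \<phi>" "t \<in> \<Omega>"
  shows "norm (half_step y0 t \<phi> y) \<le> K"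
proof -
  \<comment> \<open>compare with \<open>t = 0\<close>, where the log-partition function is constant\<close>
  have "log_partition 0 \<phi> y0 = log_partition 0 \<phi> y" by (simp add: log_partition_def)
  then have "norm (half_step y0 t \<phi> y) \<le> 4 * (norm t * C)"
    using log_partition_difference[OF assms(1) assms(1) assms(2) zero_in_Omega, of 0 y0 y] by (simp add: half_step_def)
  also have "\<dots> \<le> K" using Omega_norm[OF assms(2)] by (simp add: K_def mult.commute)
  finally show ?thesis .
qed

lemma log_partition_real: "log_partition (of_real s) (\<lambda>x. of_real (f x)) y = of_real (ln (\<integral>x. exp (f x - s * c x y) \<partial>M))"
  if "0 < (\<integral>x. exp (f x - s * c x y) \<partial>M)"
proof -
  have "(\<integral>x. exp (complex_of_real (f x) - of_real s * of_real (c x y)) \<partial>M)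
    = of_real (\<integral>x. exp (f x - s * c x y) \<partial>M)"
    by (simp flip: integral_complex_of_real of_real_mult of_real_diff exp_of_real)
  then show ?thesis using that by (simp add: log_partition_def Ln_of_real)
qed

lemma real_integral_pos:
  assumes "f \<in> borel_measurable M" "\<And>x. \<bar>f x\<bar> \<le> B"
  shows "0 < (\<integral>x. exp (f x - s * c x y) \<partial>M)"
proof -
  have "\<bar>s * c x y\<bar> \<le> \<bar>s\<bar> * C" for x
    unfolding abs_mult using c_bound by (intro mult_left_mono) auto
  then have b: "- (B + \<bar>s\<bar> * C) \<le> f x - s * c x y" "f x - s * c x y \<le> B + \<bar>s\<bar> * C" for x
    using assms(2)[of x] by (auto simp: abs_le_iff add_mono) (smt (verit))+
  have "exp (- (B + \<bar>s\<bar> * C)) = (\<integral>x. exp (- (B + \<bar>s\<bar> * C)) \<partial>M)" by (simp add: M.prob_space)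
  also have "\<dots> \<le> (\<integral>x. exp (f x - s * c x y) \<partial>M)"
    by (rule integral_mono[OF _ M.bounded_integrable[where B = "exp (B + \<bar>s\<bar> * C)"]])
       (use b assms in auto)
  finally show ?thesis using exp_gt_zero[of "- (B + \<bar>s\<bar> * C)"] by linarith
qed

text \<open>The half-step of the real data \<open>Re t\<close>, \<open>Re \<phi>\<close> is real, so
  the imaginary oscillation is at most the oscillation of the difference from it. The two potentials
  differ by i Im \<phi>, of oscillation at most \<delta>/32, and the two inverse temperatures by i
  Im t; the contraction makes room for the second error.\<close>

lemma admissible_half_step:
  assumes "admissible \<phi>" "t \<in> \<Omega>"
  shows "cost_kernel.admissible N C R (half_step y0 t \<phi>)"
proof -
  interpret swap: cost_kernel N M "\<lambda>y x. c x y" C R by (rule swap)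
  obtain B where B: "norm (\<phi> x) \<le> B" for x using assms by (auto simp: admissible_def)
  have "\<bar>Re (\<phi> x)\<bar> \<le> B" for x using abs_Re_le_cmod[of "\<phi> x"] B[of x] by linarith
  then have pos: "0 < (\<integral>x. exp (Re (\<phi> x) - Re t * c x y) \<partial>M)" for y
    using admissible_meas[OF assms(1)] by (intro real_integral_pos[where B = B]) auto
  have ImC: "\<bar>Im t\<bar> * C \<le> \<delta>\<^sup>2 / 256" using assms(2) by (simp add: \<Omega>_def)
  have nt: "norm (t - of_real (Re t)) = \<bar>Im t\<bar>"
    by (simp add: cmod_def)
  have "\<bar>Im (half_step y0 t \<phi> y) - Im (half_step y0 t \<phi> y')\<bar> \<le> \<delta> / 32" for y y'
  proof -
    have "norm ((log_partition t \<phi> y - log_partition t \<phi> y') - (log_partition (Re t) (\<lambda>x. Re (\<phi> x)) y - log_partition (Re t) (\<lambda>x. Re (\<phi> x)) y'))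
      \<le> (1 - \<delta> / 2) * (\<delta> / 32) + 4 * (norm (t - of_real (Re t)) * C)"
    proof (rule log_partition_difference[OF assms(1) admissible_Re[OF assms(1)] assms(2) Re_in_Omega[OF assms(2)]])
      fix x x'
      have "(\<phi> x - Re (\<phi> x)) - (\<phi> x' - Re (\<phi> x')) = \<i> * of_real (Im (\<phi> x) - Im (\<phi> x'))"
        by (simp add: complex_eq_iff)
      then show "norm ((\<phi> x - Re (\<phi> x)) - (\<phi> x' - Re (\<phi> x'))) \<le> \<delta> / 32"
        using assms(1) by (simp add: norm_mult admissible_def del: of_real_diff)
    qed
    also have "\<dots> \<le> (1 - \<delta> / 2) * (\<delta> / 32) + 4 * (\<delta>\<^sup>2 / 256)" using ImC by (simp add: nt)
    also have "\<dots> = \<delta> / 32" by (simp add: field_simps power2_eq_square)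
    finally have "\<bar>Im ((log_partition t \<phi> y - log_partition t \<phi> y')
        - (log_partition (Re t) (\<lambda>x. Re (\<phi> x)) y - log_partition (Re t) (\<lambda>x. Re (\<phi> x)) y'))\<bar> \<le> \<delta> / 32"
      using abs_Im_le_cmod order_trans by blast
    then show ?thesis by (simp add: half_step_def log_partition_real[OF pos] abs_minus_commute)
  qed
  moreover have "half_step y0 t \<phi> \<in> borel_measurable N"
    unfolding half_step_def[abs_def] using log_partition_measurable[OF assms(1)] by measurable
  moreover have "swap.\<delta> = \<delta>" by (simp add: swap.\<delta>_def \<delta>_def)
  ultimately show ?thesis
    unfolding swap.admissible_def using half_step_norm[OF assms] half_step_at_base[of y0 t \<phi>]
    by (metis zero_complex.simps(2))
qed

lemma log_partition_holomorphic:
  assumes hol: "\<And>x. (\<lambda>t. \<phi> t x) holomorphic_on \<Omega>"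
    and adm: "\<And>t. t \<in> \<Omega> \<Longrightarrow> admissible (\<phi> t)"
    and B: "\<And>t x. t \<in> \<Omega> \<Longrightarrow> norm (\<phi> t x) \<le> B"
  shows "(\<lambda>t. log_partition t (\<phi> t) y) holomorphic_on \<Omega>"
proof -
  have w: "complex_weight M (\<lambda>x. \<phi> t x - t * c x y) (\<delta> / 16) (B + (C * R + 1))" if "t \<in> \<Omega>" for t
    using weight[OF adm[OF that] B[OF that] that] .
  have "(\<lambda>t. \<integral>x. exp (\<phi> t x - t * c x y) \<partial>M) holomorphic_on \<Omega>"
  proof (rule M.holomorphic_on_integral[OF open_Omega, where B = "exp (B + (C * R + 1))"])
    show "(\<lambda>t. exp (\<phi> t x - t * c x y)) holomorphic_on \<Omega>" for x
      by (intro holomorphic_intros hol)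
    fix t assume t: "t \<in> \<Omega>"
    interpret w: complex_weight M "\<lambda>x. \<phi> t x - t * c x y" "\<delta> / 16" "B + (C * R + 1)"
      by (rule w[OF t])
    show "(\<lambda>x. exp (\<phi> t x - t * c x y)) \<in> borel_measurable M"
      using w.g_meas by measurable
    show "norm (exp (\<phi> t x - t * c x y)) \<le> exp (B + (C * R + 1))" for x
      using w.Re_g_bounds by simp
  qed
  then show ?thesis
    unfolding log_partition_def using complex_weight.exp_integral_not_nonpos[OF w]
    by (intro holomorphic_on_Ln') auto
qed

section \<open>Iteration, fixed point and holomorphic dependence on the inverse temperature\<close>

text \<open>\<open>undefined\<close> is used as an arbitrary but fixed base point, one in each
  factor.\<close>

definition sinkhorn :: "complex \<Rightarrow> ('a \<Rightarrow> complex) \<Rightarrow> 'a \<Rightarrow> complex" where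
  "sinkhorn t \<phi> = cost_kernel.half_step N (\<lambda>y x. c x y) undefined t (half_step undefined t \<phi>)"

lemma sinkhorn_admissible:
  assumes "admissible \<phi>" "t \<in> \<Omega>"
  shows "admissible (sinkhorn t \<phi>)"
  unfolding sinkhorn_def using cost_kernel.admissible_half_step[OF swap admissible_half_step[OF assms] assms(2)] .

lemma sinkhorn_norm:
  assumes "admissible \<phi>" "t \<in> \<Omega>"
  shows "norm (sinkhorn t \<phi> x) \<le> K"
  unfolding sinkhorn_def using cost_kernel.half_step_norm[OF swap admissible_half_step[OF assms] assms(2)] .

lemma sinkhorn_at_base: "sinkhorn t \<phi> undefined = 0"
  by (simp add: sinkhorn_def cost_kernel.half_step_at_base[OF swap])

lemma sinkhorn_contract:
  assumes "admissible \<phi>1" "admissible \<phi>2" "t \<in> \<Omega>"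
    and "\<And>x x'. norm ((\<phi>1 x - \<phi>2 x) - (\<phi>1 x' - \<phi>2 x')) \<le> b"
  shows "norm ((sinkhorn t \<phi>1 x - sinkhorn t \<phi>2 x) - (sinkhorn t \<phi>1 x' - sinkhorn t \<phi>2 x')) \<le> (1 - \<delta> / 2) * b"
proof -
  interpret swap: cost_kernel N M "\<lambda>y x. c x y" C R by (rule swap)
  show ?thesis unfolding sinkhorn_def
    by (intro swap.half_step_contract admissible_half_step half_step_osc assms)
qed

definition sinkhorn_iter :: "nat \<Rightarrow> complex \<Rightarrow> 'a \<Rightarrow> complex" where
  "sinkhorn_iter n t = (sinkhorn t ^^ n) (\<lambda>_. 0)"

lemma sinkhorn_iter_0: "sinkhorn_iter 0 t = (\<lambda>_. 0)" and sinkhorn_iter_Suc: "sinkhorn_iter (Suc n) t = sinkhorn t (sinkhorn_iter n t)"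
  by (simp_all add: sinkhorn_iter_def)

lemma sinkhorn_iter_admissible: "t \<in> \<Omega> \<Longrightarrow> admissible (sinkhorn_iter n t)"
  by (induction n) (simp_all add: sinkhorn_iter_0 sinkhorn_iter_Suc admissible_zero sinkhorn_admissible)

lemma K_pos: "0 < K"
  using C_pos R_pos by (simp add: K_def add_pos_pos)

lemma sinkhorn_iter_norm: "t \<in> \<Omega> \<Longrightarrow> norm (sinkhorn_iter n t x) \<le> K"
  using K_pos by (cases n) (simp_all add: sinkhorn_iter_0 sinkhorn_iter_Suc sinkhorn_norm sinkhorn_iter_admissible)

lemma sinkhorn_iter_at_base: "sinkhorn_iter n t undefined = 0"
  by (cases n) (simp_all add: sinkhorn_iter_0 sinkhorn_iter_Suc sinkhorn_at_base)

lemma sinkhorn_iter_step_osc: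
  assumes "t \<in> \<Omega>"
  shows "norm ((sinkhorn_iter (Suc n) t x - sinkhorn_iter n t x) - (sinkhorn_iter (Suc n) t x' - sinkhorn_iter n t x'))
    \<le> (1 - \<delta> / 2) ^ n * (2 * K)"
proof (induction n arbitrary: x x')
  case 0
  show ?case
    using sinkhorn_iter_norm[OF assms, of 1 x] sinkhorn_iter_norm[OF assms, of 1 x']
      norm_triangle_ineq4[of "sinkhorn_iter 1 t x" "sinkhorn_iter 1 t x'"]
    by (simp add: sinkhorn_iter_0)
next
  case (Suc n)
  show ?case
    using sinkhorn_contract[OF sinkhorn_iter_admissible sinkhorn_iter_admissible _ Suc, of t] assms
    by (simp add: sinkhorn_iter_Suc mult.assoc)
qed

lemma sinkhorn_iter_step:
  assumes "t \<in> \<Omega>"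
  shows "norm (sinkhorn_iter (Suc n) t x - sinkhorn_iter n t x) \<le> (1 - \<delta> / 2) ^ n * (2 * K)"
  using sinkhorn_iter_step_osc[OF assms, of n x undefined] by (simp add: sinkhorn_iter_at_base)

text \<open>Written as a telescoping series because the increments decay geometrically at a rate
  independent of \<open>t\<close> and \<open>x\<close>: the M-test then gives convergence uniform in
  both at once.\<close>

definition potential :: "complex \<Rightarrow> 'a \<Rightarrow> complex" where
  "potential t x = (\<Sum>n. sinkhorn_iter (Suc n) t x - sinkhorn_iter n t x)"

lemma sinkhorn_iter_uniform_limit:
  "uniform_limit (\<Omega> \<times> UNIV) (\<lambda>n (t, x). sinkhorn_iter n t x) (\<lambda>(t, x). potential t x) sequentially"
proof -
  have "uniform_limit (\<Omega> \<times> UNIV) (\<lambda>n p. \<Sum>i<n. sinkhorn_iter (Suc i) (fst p) (snd p) - sinkhorn_iter i (fst p) (snd p))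
     (\<lambda>p. \<Sum>i. sinkhorn_iter (Suc i) (fst p) (snd p) - sinkhorn_iter i (fst p) (snd p)) sequentially"
  proof (rule Weierstrass_m_test)
    show "summable (\<lambda>n. (1 - \<delta> / 2) ^ n * (2 * K))"
      using delta_bounds by (intro summable_mult2 summable_geometric) simp
  qed (use sinkhorn_iter_step in auto)
  moreover have "(\<Sum>i<n. sinkhorn_iter (Suc i) t x - sinkhorn_iter i t x) = sinkhorn_iter n t x" for n t x
    using sum_lessThan_telescope[of "\<lambda>i. sinkhorn_iter i t x" n] by (simp add: sinkhorn_iter_0)
  ultimately show ?thesis
    by (simp add: potential_def case_prod_unfold)
qed

lemma sinkhorn_iter_lim: "t \<in> \<Omega> \<Longrightarrow> (\<lambda>n. sinkhorn_iter n t x) \<longlonglongrightarrow> potential t x"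
  using tendsto_uniform_limitI[OF sinkhorn_iter_uniform_limit, of "(t, x)"] by simp

lemma sinkhorn_iter_uniform:
  assumes "0 < e"
  obtains n0 where "\<And>n t x. n \<ge> n0 \<Longrightarrow> t \<in> \<Omega> \<Longrightarrow> norm (sinkhorn_iter n t x - potential t x) < e"
proof -
  from uniform_limitD[OF sinkhorn_iter_uniform_limit assms]
  obtain n0 where "\<forall>n\<ge>n0. \<forall>p\<in>\<Omega> \<times> UNIV. norm (sinkhorn_iter n (fst p) (snd p) - potential (fst p) (snd p)) < e"
    by (auto simp: eventually_sequentially dist_norm)
  then show ?thesis by (intro that[of n0]) auto
qed

lemma potential_norm: "t \<in> \<Omega> \<Longrightarrow> norm (potential t x) \<le> K"
  by (rule tendsto_upperbound[OF tendsto_norm[OF sinkhorn_iter_lim]]) (simp_all add: sinkhorn_iter_norm)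

lemma potential_at_base: "t \<in> \<Omega> \<Longrightarrow> potential t undefined = 0"
  using sinkhorn_iter_lim[of t undefined] by (simp add: sinkhorn_iter_at_base LIMSEQ_const_iff)

lemma potential_admissible:
  assumes t: "t \<in> \<Omega>" shows "admissible (potential t)"
  unfolding admissible_def
proof (intro conjI)
  show "potential t \<in> borel_measurable M"
    by (rule borel_measurable_LIMSEQ_metric[OF _ sinkhorn_iter_lim[OF t]])
       (use sinkhorn_iter_admissible[OF t] admissible_meas in blast)
  show "\<exists>B. \<forall>x. norm (potential t x) \<le> B" using potential_norm[OF t] by blast
  show "\<exists>x. Im (potential t x) = 0" using potential_at_base[OF t] by (metis zero_complex.simps(2))
  show "\<forall>x x'. \<bar>Im (potential t x) - Im (potential t x')\<bar> \<le> \<delta> / 32"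
  proof (intro allI)
    fix x x'
    have "(\<lambda>n. \<bar>Im (sinkhorn_iter n t x) - Im (sinkhorn_iter n t x')\<bar>) \<longlonglongrightarrow> \<bar>Im (potential t x) - Im (potential t x')\<bar>"
      by (intro tendsto_intros sinkhorn_iter_lim t)
    then show "\<bar>Im (potential t x) - Im (potential t x')\<bar> \<le> \<delta> / 32"
      by (rule tendsto_upperbound)
         (use sinkhorn_iter_admissible[OF t] in \<open>auto simp: admissible_def\<close>)
  qed
qed

lemma potential_fixed_point:
  assumes t: "t \<in> \<Omega>" shows "sinkhorn t (potential t) = potential t"
proof
  fix x
  have "(\<lambda>n. sinkhorn t (sinkhorn_iter n t) x) \<longlonglongrightarrow> sinkhorn t (potential t) x"
  proof (rule LIMSEQ_I)
    fix r :: real assume "0 < r"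
    \<comment> \<open>Sup norm distance below r/2 bounds the oscillation of the difference by r. The
      contraction factor makes the final inequality strict, and both images vanish at the base
      point, so oscillation controls the pointwise distance.\<close>
    then obtain n0 where n0: "\<And>n x. n \<ge> n0 \<Longrightarrow> norm (sinkhorn_iter n t x - potential t x) < r / 2"
      using sinkhorn_iter_uniform[of "r / 2"] t by (metis half_gt_zero)
    have "norm (sinkhorn t (sinkhorn_iter n t) x - sinkhorn t (potential t) x) < r" if n: "n \<ge> n0" for n
    proof -
      have "norm ((sinkhorn t (sinkhorn_iter n t) x - sinkhorn t (potential t) x)
        - (sinkhorn t (sinkhorn_iter n t) undefined - sinkhorn t (potential t) undefined)) \<le> (1 - \<delta> / 2) * r"
      proof (rule sinkhorn_contract[OF sinkhorn_iter_admissible[OF t] potential_admissible[OF t] t])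
        fix x x'
        show "norm ((sinkhorn_iter n t x - potential t x) - (sinkhorn_iter n t x' - potential t x')) \<le> r"
          using n0[OF n, of x] n0[OF n, of x']
            norm_triangle_ineq4[of "sinkhorn_iter n t x - potential t x" "sinkhorn_iter n t x' - potential t x'"]
          by linarith
      qed
      also have "\<dots> < r" using \<open>0 < r\<close> delta_bounds by (simp add: algebra_simps)
      finally show ?thesis by (simp add: sinkhorn_at_base)
    qed
    then show "\<exists>n0. \<forall>n\<ge>n0. norm (sinkhorn t (sinkhorn_iter n t) x - sinkhorn t (potential t) x) < r" by blast
  qed
  moreover have "(\<lambda>n. sinkhorn t (sinkhorn_iter n t) x) \<longlonglongrightarrow> potential t x"
    using LIMSEQ_Suc[OF sinkhorn_iter_lim[OF t, of x]] by (simp add: sinkhorn_iter_Suc)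
  ultimately show "sinkhorn t (potential t) x = potential t x" using LIMSEQ_unique by blast
qed

lemma sinkhorn_holomorphic:
  assumes "\<And>x. (\<lambda>t. \<phi> t x) holomorphic_on \<Omega>"
    and "\<And>t. t \<in> \<Omega> \<Longrightarrow> admissible (\<phi> t)"
    and "\<And>t x. t \<in> \<Omega> \<Longrightarrow> norm (\<phi> t x) \<le> B"
  shows "(\<lambda>t. sinkhorn t (\<phi> t) x) holomorphic_on \<Omega>"
proof -
  interpret swap: cost_kernel N M "\<lambda>y x. c x y" C R by (rule swap)
  show ?thesis unfolding sinkhorn_def swap.half_step_def
    by (intro holomorphic_on_diff swap.log_partition_holomorphic[where B = K])
       (auto simp: half_step_def[abs_def] intro!: holomorphic_intros log_partition_holomorphic assms admissible_half_step[unfolded half_step_def[abs_def]]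
         half_step_norm[unfolded half_step_def])
qed

lemma sinkhorn_iter_holomorphic: "(\<lambda>t. sinkhorn_iter n t x) holomorphic_on \<Omega>"
proof (induction n arbitrary: x)
  case (Suc n)
  show ?case unfolding sinkhorn_iter_Suc
    by (rule sinkhorn_holomorphic[OF Suc sinkhorn_iter_admissible sinkhorn_iter_norm])
qed (simp add: sinkhorn_iter_0)

lemma potential_holomorphic: "(\<lambda>t. potential t x) holomorphic_on \<Omega>"
proof (rule holomorphic_uniform_sequence[OF open_Omega, where f = "\<lambda>n t. sinkhorn_iter n t x"])
  fix t assume "t \<in> \<Omega>"
  then obtain d where d: "0 < d" "cball t d \<subseteq> \<Omega>" using open_Omega open_contains_cball by blast
  have "uniform_limit \<Omega> (\<lambda>n t. sinkhorn_iter n t x) (\<lambda>t. potential t x) sequentially"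
    unfolding uniform_limit_iff eventually_sequentially dist_norm
    using sinkhorn_iter_uniform by metis
  then show "\<exists>d. 0 < d \<and> cball t d \<subseteq> \<Omega> \<and>
      uniform_limit (cball t d) (\<lambda>n t. sinkhorn_iter n t x) (\<lambda>t. potential t x) sequentially"
    using d uniform_limit_on_subset by blast
qed (rule sinkhorn_iter_holomorphic)

section \<open>The dual value and the Schroedinger system\<close>

text \<open>The dual functional is the sum of the integrals of both potentials. The half-step is
  normalised at the base point; subtracting the log-partition there restores the true second
  potential, which is minus the log-partition function.\<close>

definition dual_value :: "complex \<Rightarrow> complex" where
  "dual_value t = (\<integral>x. potential t x \<partial>M) + (\<integral>y. half_step undefined t (potential t) y \<partial>N)
    - log_partition t (potential t) undefined"

lemma dual_value_holomorphic: "dual_value holomorphic_on \<Omega>"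
proof -
  have log_partition: "(\<lambda>t. log_partition t (potential t) y) holomorphic_on \<Omega>" for y
    by (rule log_partition_holomorphic[OF potential_holomorphic potential_admissible potential_norm])
  have "(\<lambda>t. \<integral>x. potential t x \<partial>M) holomorphic_on \<Omega>"
    using admissible_meas[OF potential_admissible]
    by (intro M.holomorphic_on_integral[OF open_Omega potential_holomorphic _ potential_norm])
  moreover have "(\<lambda>t. \<integral>y. half_step undefined t (potential t) y \<partial>N) holomorphic_on \<Omega>"
  proof (rule N.holomorphic_on_integral[OF open_Omega])
    show "(\<lambda>t. half_step undefined t (potential t) y) holomorphic_on \<Omega>" for y
      unfolding half_step_def by (intro holomorphic_intros log_partition)
    fix t assume t: "t \<in> \<Omega>"
    show "half_step undefined t (potential t) \<in> borel_measurable N"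
      using cost_kernel.admissible_meas[OF swap admissible_half_step[OF potential_admissible[OF t] t]] .
    show "norm (half_step undefined t (potential t) y) \<le> K" for y
      by (rule half_step_norm[OF potential_admissible[OF t] t])
  qed
  ultimately show ?thesis unfolding dual_value_def[abs_def] by (intro holomorphic_intros log_partition)
qed

lemma half_step_real:
  assumes "admissible \<phi>" "\<And>x. Im (\<phi> x) = 0"
  shows "Im (log_partition (of_real s) \<phi> y) = 0" and "Im (half_step y0 (of_real s) \<phi> y) = 0"
proof -
  obtain B where B: "norm (\<phi> x) \<le> B" for x using assms by (auto simp: admissible_def)
  have *: "\<phi> = (\<lambda>x. of_real (Re (\<phi> x)))" using assms(2) by (auto simp: complex_eq_iff)
  have "\<bar>Re (\<phi> x)\<bar> \<le> B" for x using abs_Re_le_cmod[of "\<phi> x"] B[of x] by linarith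
  then have "0 < (\<integral>x. exp (Re (\<phi> x) - s * c x y) \<partial>M)" for y
    using admissible_meas[OF assms(1)] by (intro real_integral_pos[where B = B]) auto
  from log_partition_real[OF this] have "Im (log_partition (of_real s) \<phi> y) = 0" for y
    by (subst *) simp
  then show "Im (log_partition (of_real s) \<phi> y) = 0" "Im (half_step y0 (of_real s) \<phi> y) = 0"
    by (simp_all add: half_step_def)
qed

lemma potential_real:
  assumes "of_real s \<in> \<Omega>" shows "Im (potential (of_real s) x) = 0"
proof -
  interpret swap: cost_kernel N M "\<lambda>y x. c x y" C R by (rule swap)
  have "Im (sinkhorn_iter n (of_real s) x) = 0" for n x
  proof (induction n arbitrary: x)
    case (Suc n)
    show ?case unfolding sinkhorn_iter_Suc sinkhorn_def
      by (intro swap.half_step_real half_step_real admissible_half_step sinkhorn_iter_admissible assms Suc)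
  qed (simp add: sinkhorn_iter_0)
  then show ?thesis
    using tendsto_Im[OF sinkhorn_iter_lim[OF assms, of x]] by (simp add: LIMSEQ_const_iff)
qed

text \<open>For real \<open>t\<close> all iterates, hence their limit, are real. With
  \<open>g\<close> the unnormalised negative log-partition of \<open>f\<close>, the equation over
  \<open>M\<close> holds by construction, and the equation over \<open>N\<close> expresses the
  fixed-point property.\<close>

lemma schroedinger_potentials:
  assumes s: "\<bar>s\<bar> < R"
  shows "\<exists>f g B. f \<in> borel_measurable M \<and> g \<in> borel_measurable N
    \<and> (\<forall>x. \<bar>f x\<bar> \<le> B) \<and> (\<forall>y. \<bar>g y\<bar> \<le> B)
    \<and> (\<forall>y. (\<integral>x. exp (f x + g y - s * c x y) \<partial>M) = 1)
    \<and> (\<forall>x. (\<integral>y. exp (f x + g y - s * c x y) \<partial>N) = 1)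
    \<and> dual_value (of_real s) = of_real ((\<integral>x. f x \<partial>M) + (\<integral>y. g y \<partial>N))"
proof -
  interpret swap: cost_kernel N M "\<lambda>y x. c x y" C R by (rule swap)
  interpret pair_prob_space M N ..
  define t where "t = complex_of_real s"
  define \<phi> where "\<phi> = potential t"
  define \<psi> where "\<psi> = half_step undefined t \<phi>"
  have t: "t \<in> \<Omega>" unfolding t_def by (rule of_real_in_Omega[OF s])
  have \<phi>: "admissible \<phi>" unfolding \<phi>_def by (rule potential_admissible[OF t])
  have \<psi>: "swap.admissible \<psi>" unfolding \<psi>_def by (rule admissible_half_step[OF \<phi> t])
  have \<phi>_Im: "Im (\<phi> x) = 0" for x
    unfolding \<phi>_def t_def by (rule potential_real[OF t[unfolded t_def]])
  define l where "l = Re (log_partition t \<phi> undefined)"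
  have l: "log_partition t \<phi> undefined = of_real l"
    using half_step_real(1)[OF \<phi> \<phi>_Im, of s undefined] by (simp add: l_def t_def complex_eq_iff)
  define m where "m = Re (swap.log_partition t \<psi> undefined)"
  have \<psi>_Im: "Im (\<psi> y) = 0" for y
    unfolding \<psi>_def t_def by (rule half_step_real(2)[OF \<phi> \<phi>_Im])
  have m: "swap.log_partition t \<psi> undefined = of_real m"
    using swap.half_step_real(1)[OF \<psi> \<psi>_Im, of s undefined] by (simp add: m_def t_def complex_eq_iff)
  define f where "f = (\<lambda>x. Re (\<phi> x))"
  \<comment> \<open>\<psi> vanishes at the base point; subtracting \<open>l\<close> restores the
    lost constant, so that -g is the log-partition function itself.\<close>
  define g where "g = (\<lambda>y. Re (\<psi> y) - l)"
  have \<phi>f: "\<phi> x = of_real (f x)" for x using \<phi>_Im by (simp add: f_def complex_eq_iff)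
  have \<psi>g: "\<psi> y = of_real (g y + l)" for y using \<psi>_Im by (simp add: g_def complex_eq_iff)
  have f_meas [measurable]: "f \<in> borel_measurable M"
    unfolding f_def using admissible_meas[OF \<phi>] by measurable
  have g_meas [measurable]: "g \<in> borel_measurable N"
    unfolding g_def using swap.admissible_meas[OF \<psi>] by measurable
  have f_bound: "\<bar>f x\<bar> \<le> K" for x
    using abs_Re_le_cmod[of "\<phi> x"] potential_norm[OF t, of x] by (simp add: f_def \<phi>_def)
  have g_bound: "\<bar>g y\<bar> \<le> K + \<bar>l\<bar>" for y
    using abs_Re_le_cmod[of "\<psi> y"] half_step_norm[OF \<phi> t, of undefined y] by (simp add: g_def \<psi>_def)
  have real_exp: "(\<integral>x. exp (complex_of_real (u x)) \<partial>A) = of_real (\<integral>x. exp (u x) \<partial>A)"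
    for u and A :: "'c measure"
    by (simp flip: integral_complex_of_real exp_of_real)
  have g_eq: "of_real (- g y) = log_partition t \<phi> y" for y
  proof -
    have "log_partition t \<phi> y = of_real l - \<psi> y" by (simp add: \<psi>_def half_step_def l)
    then show ?thesis by (simp add: \<psi>g)
  qed
  have Mint: "(\<integral>x. exp (f x + g y - s * c x y) \<partial>M) = 1" for y
  proof -
    have "complex_of_real (exp (- g y)) = exp (log_partition t \<phi> y)" by (simp only: g_eq[symmetric] exp_of_real)
    also have "\<dots> = of_real (\<integral>x. exp (f x - s * c x y) \<partial>M)"
      unfolding exp_log_partition[OF \<phi> t] unfolding \<phi>f t_def by (simp flip: real_exp)
    finally have "(\<integral>x. exp (f x - s * c x y) \<partial>M) = exp (- g y)" by (simp only: of_real_eq_iff)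
    moreover have "(\<integral>x. exp (f x + g y - s * c x y) \<partial>M) = exp (g y) * (\<integral>x. exp (f x - s * c x y) \<partial>M)"
      by (simp flip: integral_mult_right_zero exp_add add: algebra_simps)
    ultimately show ?thesis by (simp flip: exp_add)
  qed
  have Nint: "(\<integral>y. exp (f x + g y - s * c x y) \<partial>N) = exp (m - l)" for x
  proof -
    have "\<phi> x = sinkhorn t \<phi> x" unfolding \<phi>_def by (simp add: potential_fixed_point[OF t])
    also have "\<dots> = of_real m - swap.log_partition t \<psi> x" by (simp add: sinkhorn_def swap.half_step_def \<psi>_def flip: m)
    finally have "swap.log_partition t \<psi> x = of_real (m - f x)" by (simp add: \<phi>f)
    then have "complex_of_real (exp (m - f x)) = exp (swap.log_partition t \<psi> x)" by (simp only: exp_of_real)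
    also have "\<dots> = of_real (\<integral>y. exp (g y + l - s * c x y) \<partial>N)"
      unfolding swap.exp_log_partition[OF \<psi> t] unfolding \<psi>g t_def by (simp flip: real_exp)
    finally have "(\<integral>y. exp (g y + l - s * c x y) \<partial>N) = exp (m - f x)" by (simp only: of_real_eq_iff)
    moreover have "(\<integral>y. exp (f x + g y - s * c x y) \<partial>N)
        = exp (f x - l) * (\<integral>y. exp (g y + l - s * c x y) \<partial>N)"
      by (simp flip: integral_mult_right_zero exp_add add: algebra_simps)
    ultimately show ?thesis by (simp flip: exp_add)
  qed
  define E where "E = (\<lambda>x y. exp (f x + g y - s * c x y))"
  have c_meas' [measurable]: "(\<lambda>p. c (fst p) (snd p)) \<in> borel_measurable (M \<Otimes>\<^sub>M N)"
    using c_meas by (simp add: case_prod_unfold)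
  have "integrable (M \<Otimes>\<^sub>M N) (\<lambda>(x, y). E x y)"
  proof (rule bounded_integrable[where B = "exp (K + (K + \<bar>l\<bar>) + \<bar>s\<bar> * C)"])
    show "(\<lambda>(x, y). E x y) \<in> borel_measurable (M \<Otimes>\<^sub>M N)"
      unfolding E_def case_prod_unfold by measurable
    fix p :: "'a \<times> 'b"
    have "\<bar>s * c (fst p) (snd p)\<bar> \<le> \<bar>s\<bar> * C"
      unfolding abs_mult using c_bound by (intro mult_left_mono) auto
    then show "norm (case p of (x, y) \<Rightarrow> E x y) \<le> exp (K + (K + \<bar>l\<bar>) + \<bar>s\<bar> * C)"
      using f_bound[of "fst p"] g_bound[of "snd p"]
      by (simp add: E_def case_prod_unfold abs_le_iff)
  qed
  \<comment> \<open>the fixed point only solves the system up to a constant, which the total mass forces to vanish\<close>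
  from Fubini_integral[OF this] have "exp (m - l) = 1"
    unfolding E_def by (simp add: Mint Nint M.prob_space N.prob_space)
  moreover have "dual_value t = of_real ((\<integral>x. f x \<partial>M) + (\<integral>y. g y \<partial>N))"
  proof -
    have "integrable N (\<lambda>y. g y)"
      by (rule N.bounded_integrable[where B = "K + \<bar>l\<bar>"]) (use g_bound in auto)
    then have "(\<integral>y. g y + l \<partial>N) = (\<integral>y. g y \<partial>N) + l"
      by (simp add: N.prob_space)
    then have "(\<integral>y. \<psi> y \<partial>N) = of_real (\<integral>y. g y \<partial>N) + of_real l"
      unfolding \<psi>g integral_complex_of_real by simp
    moreover have "(\<integral>x. \<phi> x \<partial>M) = of_real (\<integral>x. f x \<partial>M)"
      unfolding \<phi>f integral_complex_of_real ..
    ultimately show ?thesis by (simp add: dual_value_def l flip: \<phi>_def \<psi>_def)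
  qed
  moreover have "\<bar>f x\<bar> \<le> K + \<bar>l\<bar>" for x using f_bound[of x] by simp
  ultimately show ?thesis
    using f_meas g_meas g_bound Mint Nint unfolding t_def by (intro exI[of _ f] exI[of _ g] exI[of _ "K + \<bar>l\<bar>"]) simp
qed

end

section \<open>Relative entropy and couplings\<close>

lemma rel_entropy_cases:
  "rel_entropy p q = \<infinity> \<or> (\<exists>e. rel_entropy p q = ereal e)"
  by (simp add: rel_entropy_def Let_def)

text \<open>The Radon-Nikodym derivative of a probability measure is finite almost everywhere, so
  passing to a real-valued density loses nothing. The case distinction at density 0 disappears
  because the product with 0 is 0.\<close>

lemma rel_entropy_finiteE:
  assumes q: "prob_space q" and p: "prob_space p" and e: "rel_entropy p q = ereal e"
  obtains \<rho> where "\<rho> \<in> borel_measurable q" and "\<And>x. 0 \<le> \<rho> x" and "p = density q \<rho>"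
    and "integrable q (\<lambda>x. \<rho> x * ln (\<rho> x))" and "e = (\<integral>x. \<rho> x * ln (\<rho> x) \<partial>q)"
proof -
  interpret q: prob_space q by fact
  interpret p: prob_space p by fact
  define \<rho> where "\<rho> = (\<lambda>x. enn2real (RN_deriv q p x))"
  define g where "g = (\<lambda>x. if \<rho> x = 0 then 0 else \<rho> x * ln (\<rho> x))"
  have g: "g = (\<lambda>x. \<rho> x * ln (\<rho> x))" by (auto simp: g_def)
  have ac: "sets p = sets q" "absolutely_continuous q p" and int: "integrable q g"
    and eq: "e = (\<integral>x. g x \<partial>q)"
    using e unfolding rel_entropy_def Let_def g_def \<rho>_def by (auto split: if_splits)
  have "density q (\<lambda>x. ennreal (\<rho> x)) = density q (RN_deriv q p)"
  proof (rule density_cong)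
    show "AE x in q. ennreal (\<rho> x) = RN_deriv q p x"
      using q.RN_deriv_finite[OF p.sigma_finite_measure_axioms ac(2,1)]
      by eventually_elim (simp add: \<rho>_def ennreal_enn2real_if)
  qed (auto simp: \<rho>_def)
  then have "p = density q \<rho>" using q.density_RN_deriv[OF ac(2,1)] by simp
  then show ?thesis
    using that[of \<rho>] int eq by (simp add: g) (simp add: \<rho>_def)
qed

lemma rel_entropy_density:
  assumes q: "prob_space q" and \<rho> [measurable]: "\<rho> \<in> borel_measurable q" and pos: "\<And>x. 0 \<le> \<rho> x"
    and int: "integrable q (\<lambda>x. \<rho> x * ln (\<rho> x))"
  shows "rel_entropy (density q \<rho>) q = ereal (\<integral>x. \<rho> x * ln (\<rho> x) \<partial>q)"
proof -
  interpret q: prob_space q by fact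
  define \<rho>' where "\<rho>' = (\<lambda>x. enn2real (RN_deriv q (density q \<rho>) x))"
  define g where "g = (\<lambda>x. if \<rho>' x = 0 then 0 else \<rho>' x * ln (\<rho>' x))"
  have [measurable]: "g \<in> borel_measurable q" unfolding g_def \<rho>'_def by measurable
  have "AE x in q. ennreal (\<rho> x) = RN_deriv q (density q \<rho>) x"
    by (rule q.RN_deriv_unique) auto
  then have ae: "AE x in q. g x = \<rho> x * ln (\<rho> x)"
  proof eventually_elim
    fix x assume "ennreal (\<rho> x) = RN_deriv q (density q \<rho>) x"
    then have "\<rho>' x = \<rho> x" using pos by (simp add: \<rho>'_def flip: \<open>ennreal (\<rho> x) = _\<close>)
    then show "g x = \<rho> x * ln (\<rho> x)" by (simp add: g_def)
  qed
  have "absolutely_continuous q (density q \<rho>)" by (rule absolutely_continuousI_density) auto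
  moreover have "integrable q g \<longleftrightarrow> integrable q (\<lambda>x. \<rho> x * ln (\<rho> x))"
    by (rule integrable_cong_AE) (use ae in auto)
  moreover have "(\<integral>x. g x \<partial>q) = (\<integral>x. \<rho> x * ln (\<rho> x) \<partial>q)"
    by (rule integral_cong_AE) (use ae in auto)
  ultimately show ?thesis
    using int by (simp add: rel_entropy_def Let_def flip: \<rho>'_def g_def)
qed

section \<open>The variational inequality for entropy\<close>

text \<open>Fenchel-Young inequality for r ln r - r, whose convex conjugate is exp; it amounts to ln
  u \<le> u - 1 at u = exp(l)/r.\<close>

lemma xlogx_ge:
  fixes r l :: real
  assumes "0 \<le> r"
  shows "r * l + r - exp l \<le> r * ln r"
proof (cases "r = 0")
  case False
  then have r: "0 < r" using assms by simp
  have "ln (exp l / r) \<le> exp l / r - 1" by (rule ln_le_minus_one) (use r in simp)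
  then have "l - ln r \<le> exp l / r - 1" using r by (simp add: ln_div)
  then have "r * (l - ln r) \<le> r * (exp l / r - 1)" using r by (intro mult_left_mono) auto
  then show ?thesis using r by (simp add: algebra_simps)
qed simp

text \<open>The easy half of the Donsker-Varadhan formula: integrate \<open>xlogx_ge\<close> with r
  the density. The two linear terms cancel, since \<rho> and exp(l) both have integral 1. Applied to
  Schroedinger potentials it is weak duality.\<close>

lemma entropy_variational_le:
  assumes q: "prob_space q" and p: "prob_space p" and e: "rel_entropy p q = ereal e"
    and l: "l \<in> borel_measurable q" "\<And>x. \<bar>l x\<bar> \<le> B" and mass: "(\<integral>x. exp (l x) \<partial>q) = 1"
  shows "(\<integral>x. l x \<partial>p) \<le> e"
proof -
  interpret q: prob_space q by fact
  interpret p: prob_space p by fact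
  obtain \<rho> where
    \<rho> [measurable]: "\<rho> \<in> borel_measurable q" and pos: "\<And>x. 0 \<le> \<rho> x" and pd: "p = density q \<rho>"
    and int: "integrable q (\<lambda>x. \<rho> x * ln (\<rho> x))" and eq: "e = (\<integral>x. \<rho> x * ln (\<rho> x) \<partial>q)"
    by (rule rel_entropy_finiteE[OF q p e]) blast
  have l_meas [measurable]: "l \<in> borel_measurable q" by fact
  have lp: "l \<in> borel_measurable p" unfolding pd by simp
  have lint: "integrable p l" by (rule p.bounded_integrable[OF lp]) (use l in auto)
  have int_l: "integrable q (\<lambda>x. \<rho> x * l x)"
    using lint integrable_real_density[of \<rho> q l] pos by (simp add: pd)
  have int_l_eq: "(\<integral>x. \<rho> x * l x \<partial>q) = (\<integral>x. l x \<partial>p)"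
    using integral_real_density[of \<rho> q l] pos by (simp add: pd)
  have "integrable p (\<lambda>_. 1 :: real)" by simp
  then have int_1: "integrable q \<rho>"
    using integrable_real_density[of \<rho> q "\<lambda>_. 1"] pos by (simp add: pd)
  have "(\<integral>x. \<rho> x * 1 \<partial>q) = (\<integral>x. 1 \<partial>p)"
    using integral_real_density[of \<rho> q "\<lambda>_. 1"] pos by (simp add: pd)
  then have int_1_eq: "(\<integral>x. \<rho> x \<partial>q) = 1" by (simp add: p.prob_space)
  have le: "exp (l x) \<le> exp B" for x using l(2)[of x] by simp
  have int_e: "integrable q (\<lambda>x. exp (l x))"
    by (rule q.bounded_integrable[where B = "exp B"]) (use le in auto)
  have "(\<integral>x. \<rho> x * l x + \<rho> x - exp (l x) \<partial>q) \<le> e"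
    unfolding eq
    by (rule integral_mono) (use int int_l int_1 int_e xlogx_ge pos in auto)
  then show ?thesis using int_l int_1 int_e mass by (simp add: int_l_eq int_1_eq)
qed

lemma rel_entropy_nonneg:
  assumes "prob_space q" "prob_space p" "rel_entropy p q = ereal e"
  shows "0 \<le> e"
  using entropy_variational_le[OF assms, of "\<lambda>_. 0" 0] assms(1)
  by (simp add: prob_space.prob_space)

lemma rel_entropy_self:
  assumes "prob_space q" shows "rel_entropy q q = 0"
  using rel_entropy_density[OF assms, of "\<lambda>_. 1"] by (simp add: density_1 zero_ereal_def)

section \<open>Marginals of densities and of couplings\<close>

lemma distr_fst_density:
  assumes M: "prob_space M" and N: "prob_space N"
    and [measurable]: "\<rho> \<in> borel_measurable (M \<Otimes>\<^sub>M N)" and pos: "\<And>p. 0 \<le> \<rho> p"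
    and int: "\<And>x. x \<in> space M \<Longrightarrow> (\<integral>\<^sup>+y. ennreal (\<rho> (x, y)) \<partial>N) = 1"
  shows "distr (density (M \<Otimes>\<^sub>M N) \<rho>) M fst = M"
proof (rule measure_eqI)
  interpret M: prob_space M by fact
  interpret N: prob_space N by fact
  fix A assume "A \<in> sets (distr (density (M \<Otimes>\<^sub>M N) \<rho>) M fst)"
  then have [measurable]: "A \<in> sets M" by simp
  have [simp]: "space (density (M \<Otimes>\<^sub>M N) \<rho>) = space (M \<Otimes>\<^sub>M N)" by simp
  have m: "fst \<in> density (M \<Otimes>\<^sub>M N) \<rho> \<rightarrow>\<^sub>M M" by simp
  have "emeasure (distr (density (M \<Otimes>\<^sub>M N) \<rho>) M fst) A
    = (\<integral>\<^sup>+p. ennreal (\<rho> p) * indicator (fst -` A \<inter> space (M \<Otimes>\<^sub>M N)) p \<partial>(M \<Otimes>\<^sub>M N))"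
    by (simp add: emeasure_distr[OF m] emeasure_density)
  also have "\<dots> = (\<integral>\<^sup>+p. ennreal (\<rho> p) * indicator A (fst p) \<partial>(M \<Otimes>\<^sub>M N))"
    by (rule nn_integral_cong) (simp add: indicator_def)
  also have "\<dots> = (\<integral>\<^sup>+x. \<integral>\<^sup>+y. ennreal (\<rho> (x, y)) * indicator A x \<partial>N \<partial>M)"
    by (subst N.nn_integral_fst[symmetric]) auto
  also have "\<dots> = (\<integral>\<^sup>+x. indicator A x \<partial>M)"
    by (rule nn_integral_cong) (simp add: nn_integral_multc int)
  finally show "emeasure (distr (density (M \<Otimes>\<^sub>M N) \<rho>) M fst) A = emeasure M A" by simp
qed simp

lemma distr_snd_density:
  assumes M: "prob_space M" and N: "prob_space N"
    and [measurable]: "\<rho> \<in> borel_measurable (M \<Otimes>\<^sub>M N)" and pos: "\<And>p. 0 \<le> \<rho> p"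
    and int: "\<And>y. y \<in> space N \<Longrightarrow> (\<integral>\<^sup>+x. ennreal (\<rho> (x, y)) \<partial>M) = 1"
  shows "distr (density (M \<Otimes>\<^sub>M N) \<rho>) N snd = N"
proof (rule measure_eqI)
  interpret M: prob_space M by fact
  interpret N: prob_space N by fact
  interpret pair_prob_space M N ..
  fix A assume "A \<in> sets (distr (density (M \<Otimes>\<^sub>M N) \<rho>) N snd)"
  then have [measurable]: "A \<in> sets N" by simp
  have m: "snd \<in> density (M \<Otimes>\<^sub>M N) \<rho> \<rightarrow>\<^sub>M N" by simp
  have "emeasure (distr (density (M \<Otimes>\<^sub>M N) \<rho>) N snd) A
    = (\<integral>\<^sup>+p. ennreal (\<rho> p) * indicator (snd -` A \<inter> space (M \<Otimes>\<^sub>M N)) p \<partial>(M \<Otimes>\<^sub>M N))"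
    by (simp add: emeasure_distr[OF m] emeasure_density)
  also have "\<dots> = (\<integral>\<^sup>+p. ennreal (\<rho> p) * indicator A (snd p) \<partial>(M \<Otimes>\<^sub>M N))"
    by (rule nn_integral_cong) (simp add: indicator_def)
  also have "\<dots> = (\<integral>\<^sup>+y. \<integral>\<^sup>+x. ennreal (\<rho> (x, y)) * indicator A y \<partial>M \<partial>N)"
    by (subst nn_integral_snd[symmetric]) (auto simp: case_prod_unfold)
  also have "\<dots> = (\<integral>\<^sup>+y. indicator A y \<partial>N)"
    by (rule nn_integral_cong) (simp add: nn_integral_multc int)
  finally show "emeasure (distr (density (M \<Otimes>\<^sub>M N) \<rho>) N snd) A = emeasure N A" by simp
qed simp

lemma couplings_marginals:
  assumes "\<gamma> \<in> couplings M N"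
    and f: "f \<in> borel_measurable M" "\<And>x. \<bar>f x\<bar> \<le> B" and g: "g \<in> borel_measurable N" "\<And>y. \<bar>g y\<bar> \<le> B"
  shows "integrable \<gamma> (\<lambda>p. f (fst p))" "integrable \<gamma> (\<lambda>p. g (snd p))"
    and "(\<integral>p. f (fst p) \<partial>\<gamma>) = (\<integral>x. (f x :: real) \<partial>M)" "(\<integral>p. g (snd p) \<partial>\<gamma>) = (\<integral>y. (g y :: real) \<partial>N)"
proof -
  interpret prob_space \<gamma> using assms by (simp add: couplings_def)
  have \<gamma>: "sets \<gamma> = sets (M \<Otimes>\<^sub>M N)" "distr \<gamma> M fst = M" "distr \<gamma> N snd = N"
    using assms by (auto simp: couplings_def)
  have m: "fst \<in> \<gamma> \<rightarrow>\<^sub>M M" "snd \<in> \<gamma> \<rightarrow>\<^sub>M N"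
    using measurable_cong_sets[OF \<gamma>(1) refl] measurable_fst measurable_snd by blast+
  show "integrable \<gamma> (\<lambda>p. f (fst p))"
    by (rule bounded_integrable[where B = B]) (use m f in auto)
  show "integrable \<gamma> (\<lambda>p. g (snd p))"
    by (rule bounded_integrable[where B = B]) (use m g in auto)
  show "(\<integral>p. f (fst p) \<partial>\<gamma>) = (\<integral>x. f x \<partial>M)"
    using integral_distr[OF m(1) f(1)] by (simp add: \<gamma>(2))
  show "(\<integral>p. g (snd p) \<partial>\<gamma>) = (\<integral>y. g y \<partial>N)"
    using integral_distr[OF m(2) g(1)] by (simp add: \<gamma>(3))
qed

lemma pair_measure_in_couplings:
  assumes "prob_space M" "prob_space N"
  shows "M \<Otimes>\<^sub>M N \<in> couplings M N"
proof -
  interpret M: prob_space M by fact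
  interpret N: prob_space N by fact
  interpret pair_prob_space M N ..
  have "distr (density (M \<Otimes>\<^sub>M N) (\<lambda>_. 1)) N snd = N"
    using distr_snd_density[OF assms, of "\<lambda>_. 1"] by (simp add: M.emeasure_space_1)
  then show ?thesis
    using N.distr_pair_fst[of M] prob_space_axioms by (simp add: couplings_def density_1)
qed

section \<open>The regularized transport value\<close>

context cost_kernel
begin

abbreviation cost :: "'a \<times> 'b \<Rightarrow> real" where "cost p \<equiv> c (fst p) (snd p)"

definition transport_value :: "real \<Rightarrow> ereal" where
  "transport_value \<epsilon> = (INF \<gamma>\<in>couplings M N. ereal (\<integral>p. cost p \<partial>\<gamma>)
     + (if \<epsilon> = 0 then 0 else ereal \<epsilon> * rel_entropy \<gamma> (M \<Otimes>\<^sub>M N)))"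

definition optval :: "real \<Rightarrow> real" where "optval \<epsilon> = real_of_ereal (transport_value \<epsilon>)"

lemma cost_measurable [measurable]: "cost \<in> borel_measurable (M \<Otimes>\<^sub>M N)"
  using c_meas by (simp add: case_prod_unfold)

lemma prob_space_pair: "prob_space (M \<Otimes>\<^sub>M N)"
proof -
  interpret pair_prob_space M N ..
  show ?thesis by (rule prob_space_axioms)
qed

lemma coupling_prob: "\<gamma> \<in> couplings M N \<Longrightarrow> prob_space \<gamma>"
  by (simp add: couplings_def)

lemma coupling_measurable:
  "\<gamma> \<in> couplings M N \<Longrightarrow> f \<in> borel_measurable (M \<Otimes>\<^sub>M N) \<Longrightarrow> f \<in> borel_measurable \<gamma>"
  by (metis (mono_tags, lifting) couplings_def measurable_cong_sets mem_Collect_eq)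

lemma cost_integrable: "\<gamma> \<in> couplings M N \<Longrightarrow> integrable \<gamma> cost"
  using prob_space.bounded_integrable[OF coupling_prob coupling_measurable[OF _ cost_measurable]] c_bound
  by (metis real_norm_def)

lemma cost_integral_bound: "\<gamma> \<in> couplings M N \<Longrightarrow> \<bar>\<integral>p. cost p \<partial>\<gamma>\<bar> \<le> C"
  using prob_space.bounded_integral_norm_le[OF coupling_prob coupling_measurable[OF _ cost_measurable]] c_bound
  by (metis real_norm_def)

lemma entropy_nonneg:
  "\<gamma> \<in> couplings M N \<Longrightarrow> rel_entropy \<gamma> (M \<Otimes>\<^sub>M N) = ereal e \<Longrightarrow> 0 \<le> e"
  by (rule rel_entropy_nonneg[OF prob_space_pair coupling_prob])

lemma transport_value_le:
  assumes "\<gamma> \<in> couplings M N" "rel_entropy \<gamma> (M \<Otimes>\<^sub>M N) = ereal e"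
  shows "transport_value \<epsilon> \<le> ereal ((\<integral>p. cost p \<partial>\<gamma>) + \<epsilon> * e)"
  unfolding transport_value_def by (rule INF_lower2[OF assms(1)]) (simp add: assms(2))

text \<open>For \<epsilon> > 0 a coupling of infinite entropy has infinite value, so only finite
  entropies have to be tested. At \<epsilon> = 0 the entropy term is absent and every coupling
  competes, hence the separate \<open>transport_value_0_ge\<close>.\<close>

lemma transport_value_ge:
  assumes "0 < \<epsilon>"
    and le: "\<And>\<gamma> e. \<gamma> \<in> couplings M N \<Longrightarrow> rel_entropy \<gamma> (M \<Otimes>\<^sub>M N) = ereal e \<Longrightarrow> 0 \<le> e
      \<Longrightarrow> b \<le> (\<integral>p. cost p \<partial>\<gamma>) + \<epsilon> * e"
  shows "ereal b \<le> transport_value \<epsilon>"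
  unfolding transport_value_def
proof (rule INF_greatest)
  fix \<gamma> assume \<gamma>: "\<gamma> \<in> couplings M N"
  from rel_entropy_cases[of \<gamma> "M \<Otimes>\<^sub>M N"]
  show "ereal b \<le> ereal (\<integral>p. cost p \<partial>\<gamma>) + (if \<epsilon> = 0 then 0 else ereal \<epsilon> * rel_entropy \<gamma> (M \<Otimes>\<^sub>M N))"
  proof (elim disjE exE)
    fix e assume e: "rel_entropy \<gamma> (M \<Otimes>\<^sub>M N) = ereal e"
    show ?thesis using le[OF \<gamma> e entropy_nonneg[OF \<gamma> e]] assms(1) by (simp add: e)
  qed (use assms(1) in auto)
qed

lemma transport_value_0_ge:
  assumes "\<And>\<gamma>. \<gamma> \<in> couplings M N \<Longrightarrow> b \<le> (\<integral>p. cost p \<partial>\<gamma>)"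
  shows "ereal b \<le> transport_value 0"
  unfolding transport_value_def by (rule INF_greatest) (use assms in simp)

text \<open>The bounded cost and nonnegative entropy bound the value below; the product coupling, of
  entropy 0, bounds it above.\<close>

lemma transport_value_finite:
  assumes "0 \<le> \<epsilon>" shows "\<bar>transport_value \<epsilon>\<bar> \<noteq> \<infinity>" "transport_value \<epsilon> = ereal (optval \<epsilon>)"
proof -
  have C: "- C \<le> (\<integral>p. cost p \<partial>\<gamma>)" if "\<gamma> \<in> couplings M N" for \<gamma>
    using cost_integral_bound[OF that] by simp
  have "ereal (- C) \<le> transport_value \<epsilon>"
  proof (cases "\<epsilon> = 0")
    case True
    then show ?thesis using transport_value_0_ge[of "- C"] C by blast
  next
    case False
    show ?thesis
    proof (rule transport_value_ge)
      fix \<gamma> e assume "\<gamma> \<in> couplings M N" "0 \<le> (e :: real)"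
      then show "- C \<le> (\<integral>p. cost p \<partial>\<gamma>) + \<epsilon> * e"
        using C[of \<gamma>] mult_nonneg_nonneg[OF assms, of e] by linarith
    qed (use assms False in auto)
  qed
  moreover have "transport_value \<epsilon> \<le> ereal ((\<integral>p. cost p \<partial>(M \<Otimes>\<^sub>M N)) + \<epsilon> * 0)"
    by (rule transport_value_le)
       (simp_all add: pair_measure_in_couplings M.prob_space_axioms N.prob_space_axioms
         rel_entropy_self prob_space_pair)
  ultimately show *: "\<bar>transport_value \<epsilon>\<bar> \<noteq> \<infinity>" by auto
  show "transport_value \<epsilon> = ereal (optval \<epsilon>)" using * by (simp add: optval_def ereal_real)
qed

lemma optval_le:
  assumes "\<gamma> \<in> couplings M N" "rel_entropy \<gamma> (M \<Otimes>\<^sub>M N) = ereal e" "0 \<le> \<epsilon>"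
  shows "optval \<epsilon> \<le> (\<integral>p. cost p \<partial>\<gamma>) + \<epsilon> * e"
  using transport_value_le[OF assms(1,2), of \<epsilon>] transport_value_finite(2)[OF assms(3)] by simp

lemma optval_ge:
  assumes "0 < \<epsilon>"
    and "\<And>\<gamma> e. \<gamma> \<in> couplings M N \<Longrightarrow> rel_entropy \<gamma> (M \<Otimes>\<^sub>M N) = ereal e \<Longrightarrow> 0 \<le> e
      \<Longrightarrow> b \<le> (\<integral>p. cost p \<partial>\<gamma>) + \<epsilon> * e"
  shows "b \<le> optval \<epsilon>"
  using transport_value_ge[OF assms] transport_value_finite(2)[of \<epsilon>] assms(1) by simp

lemma optval_0_ge:
  assumes "\<And>\<gamma>. \<gamma> \<in> couplings M N \<Longrightarrow> b \<le> (\<integral>p. cost p \<partial>\<gamma>)"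
  shows "b \<le> optval 0"
  using transport_value_0_ge[OF assms] transport_value_finite(2)[of 0] by simp

lemma optval_mono: "mono_on {0..} optval"
proof (rule mono_onI)
  fix x y :: real assume xy: "x \<in> {0..}" "y \<in> {0..}" "x \<le> y"
  show "optval x \<le> optval y"
  proof (cases "y = 0")
    case False
    show ?thesis
    proof (rule optval_ge)
      fix \<gamma> e assume \<gamma>: "\<gamma> \<in> couplings M N" "rel_entropy \<gamma> (M \<Otimes>\<^sub>M N) = ereal e" "0 \<le> e"
      have "x * e \<le> y * e" using xy \<gamma>(3) by (intro mult_right_mono) auto
      then show "optval x \<le> (\<integral>p. cost p \<partial>\<gamma>) + y * e" using optval_le[OF \<gamma>(1,2), of x] xy by simp
    qed (use False xy in auto)
  qed (use xy in auto)
qed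

lemma optval_concave: "concave_on {0..} optval"
  unfolding concave_on_iff
proof (intro conjI ballI allI impI)
  fix x y u v :: real
  assume xy: "x \<in> {0..}" "y \<in> {0..}" and uv: "0 \<le> u" "0 \<le> v" "u + v = 1"
  show "u * optval x + v * optval y \<le> optval (u *\<^sub>R x + v *\<^sub>R y)"
  \<comment> \<open>The criterion \<open>optval_ge\<close> asks for a positive argument. The
    combination vanishes only if one weight is 0 and the other point is 0, or if both points are 0,
    and then the inequality is immediate.\<close>
  proof (cases "u * x + v * y = 0")
    case True
    then have "u * x = 0" "v * y = 0"
      using xy uv by (auto simp: add_nonneg_eq_0_iff)
    then consider "u = 0" "v = 1" | "v = 0" "u = 1" | "x = 0" "y = 0" using uv by auto
    then show ?thesis
    proof cases
      case 3
      then show ?thesis using uv by (simp flip: distrib_right)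
    qed simp_all
  next
    case False
    then have pos: "0 < u *\<^sub>R x + v *\<^sub>R y"
      using xy uv by (simp add: order_less_le)
    show ?thesis
    proof (rule optval_ge[OF pos])
      fix \<gamma> e assume \<gamma>: "\<gamma> \<in> couplings M N" "rel_entropy \<gamma> (M \<Otimes>\<^sub>M N) = ereal e" "0 \<le> e"
      define a where "a = (\<integral>p. cost p \<partial>\<gamma>)"
      have "u * optval x \<le> u * (a + x * e)" "v * optval y \<le> v * (a + y * e)"
        using optval_le[OF \<gamma>(1,2)] xy uv by (auto simp: a_def intro!: mult_left_mono)
      moreover have "u * (a + x * e) + v * (a + y * e) = (u + v) * a + (u * x + v * y) * e"
        by (simp add: algebra_simps)
      ultimately show "u * optval x + v * optval y \<le> (\<integral>p. cost p \<partial>\<gamma>) + (u *\<^sub>R x + v *\<^sub>R y) * e"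
        using uv by (simp add: a_def)
    qed
  qed
qed simp

text \<open>The Schroedinger equations say exactly that the density exp(f + g - s c) has the right
  marginals. The resulting coupling has entropy equal to the integral of its exponent, which attains
  the lower bound that \<open>entropy_variational_le\<close> gives for every coupling.\<close>

lemma optval_duality:
  assumes s: "0 < s"
    and f_meas: "f \<in> borel_measurable M" and g_meas: "g \<in> borel_measurable N"
    and f_bound: "\<And>x. \<bar>f x\<bar> \<le> B" and g_bound: "\<And>y. \<bar>g y\<bar> \<le> B"
    and Mint: "\<And>y. (\<integral>x. exp (f x + g y - s * c x y) \<partial>M) = 1"
    and Nint: "\<And>x. (\<integral>y. exp (f x + g y - s * c x y) \<partial>N) = 1"
  shows "optval (1 / s) = (1 / s) * ((\<integral>x. f x \<partial>M) + (\<integral>y. g y \<partial>N))"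
proof -
  interpret P: pair_prob_space M N ..
  note [measurable] = f_meas g_meas
  define l where "l = (\<lambda>p. f (fst p) + g (snd p) - s * cost p)"
  define \<rho> where "\<rho> = (\<lambda>p. exp (l p))"
  define F where "F = (\<integral>x. f x \<partial>M) + (\<integral>y. g y \<partial>N)"
  have l_meas [measurable]: "l \<in> borel_measurable (M \<Otimes>\<^sub>M N)" unfolding l_def by measurable
  have \<rho>_meas [measurable]: "\<rho> \<in> borel_measurable (M \<Otimes>\<^sub>M N)" unfolding \<rho>_def by measurable
  have l_bound: "\<bar>l p\<bar> \<le> B + B + s * C" for p
  proof -
    have "\<bar>s * cost p\<bar> \<le> s * C" unfolding abs_mult using c_bound s by (intro mult_mono) auto
    then show ?thesis using f_bound[of "fst p"] g_bound[of "snd p"] unfolding l_def by linarith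
  qed
  have l_integral: "(\<integral>p. l p \<partial>\<gamma>) = F - s * (\<integral>p. cost p \<partial>\<gamma>)" if "\<gamma> \<in> couplings M N" for \<gamma>
    using couplings_marginals[OF that f_meas f_bound g_meas g_bound] cost_integrable[OF that]
    by (simp add: l_def F_def)
  have \<rho>_bound: "\<rho> p \<le> exp (B + B + s * C)" for p
    using l_bound[of p] by (simp add: \<rho>_def)
  have nn_N: "(\<integral>\<^sup>+y. ennreal (\<rho> (x, y)) \<partial>N) = 1" for x
  proof -
    have "integrable N (\<lambda>y. \<rho> (x, y))"
      by (rule N.bounded_integrable[where B = "exp (B + B + s * C)"])
         (use \<rho>_bound space_M in \<open>auto simp: \<rho>_def intro!: measurable_Pair2[OF \<rho>_meas[unfolded \<rho>_def]]\<close>)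
    then show ?thesis
      using Nint[of x] by (subst nn_integral_eq_integral) (auto simp: \<rho>_def l_def)
  qed
  have nn_M: "(\<integral>\<^sup>+x. ennreal (\<rho> (x, y)) \<partial>M) = 1" for y
  proof -
    have "integrable M (\<lambda>x. \<rho> (x, y))"
      by (rule M.bounded_integrable[where B = "exp (B + B + s * C)"])
         (use \<rho>_bound space_N in \<open>auto simp: \<rho>_def intro!: measurable_Pair1[OF \<rho>_meas[unfolded \<rho>_def]]\<close>)
    then show ?thesis
      using Mint[of y] by (subst nn_integral_eq_integral) (auto simp: \<rho>_def l_def)
  qed
  define \<gamma> where "\<gamma> = density (M \<Otimes>\<^sub>M N) \<rho>"
  have \<rho>_nonneg: "0 \<le> \<rho> p" for p by (simp add: \<rho>_def)
  have marg: "distr \<gamma> M fst = M" "distr \<gamma> N snd = N"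
    unfolding \<gamma>_def
    using distr_fst_density[OF M.prob_space_axioms N.prob_space_axioms \<rho>_meas \<rho>_nonneg nn_N]
      distr_snd_density[OF M.prob_space_axioms N.prob_space_axioms \<rho>_meas \<rho>_nonneg nn_M] by simp_all
  \<comment> \<open>The total mass is read off from the first marginal.\<close>
  have \<gamma>_prob: "prob_space \<gamma>"
    by (rule prob_space_distrD[of fst _ M]) (simp_all add: marg M.prob_space_axioms, simp add: \<gamma>_def)
  have \<gamma>: "\<gamma> \<in> couplings M N"
    using marg \<gamma>_prob by (simp add: couplings_def) (simp add: \<gamma>_def)
  interpret \<gamma>: prob_space \<gamma> by (rule \<gamma>_prob)
  have \<rho>_int: "integrable (M \<Otimes>\<^sub>M N) \<rho>"
    by (rule P.bounded_integrable[where B = "exp (B + B + s * C)"]) (use \<rho>_bound \<rho>_nonneg in auto)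
  have "(\<integral>p. \<rho> p * 1 \<partial>(M \<Otimes>\<^sub>M N)) = (\<integral>p. 1 \<partial>\<gamma>)"
    unfolding \<gamma>_def by (subst integral_real_density) (simp_all add: \<rho>_nonneg)
  then have mass: "(\<integral>p. exp (l p) \<partial>(M \<Otimes>\<^sub>M N)) = 1"
    by (simp add: \<rho>_def \<gamma>.prob_space)
  have "integrable (M \<Otimes>\<^sub>M N) (\<lambda>p. \<rho> p * l p)"
  proof (rule P.bounded_integrable[where B = "exp (B + B + s * C) * (B + B + s * C)"])
    show "norm (\<rho> p * l p) \<le> exp (B + B + s * C) * (B + B + s * C)" for p
      using \<rho>_bound[of p] l_bound[of p] \<rho>_nonneg[of p] by (auto simp: abs_mult intro!: mult_mono)
  qed simp
  then have int: "integrable (M \<Otimes>\<^sub>M N) (\<lambda>p. \<rho> p * ln (\<rho> p))" by (simp add: \<rho>_def)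
  have "rel_entropy \<gamma> (M \<Otimes>\<^sub>M N) = ereal (\<integral>p. \<rho> p * ln (\<rho> p) \<partial>(M \<Otimes>\<^sub>M N))"
    unfolding \<gamma>_def by (rule rel_entropy_density[OF prob_space_pair \<rho>_meas \<rho>_nonneg int])
  also have "(\<integral>p. \<rho> p * ln (\<rho> p) \<partial>(M \<Otimes>\<^sub>M N)) = (\<integral>p. l p \<partial>\<gamma>)"
    unfolding \<gamma>_def by (subst integral_real_density) (simp_all add: \<rho>_nonneg, simp add: \<rho>_def)
  finally have ent: "rel_entropy \<gamma> (M \<Otimes>\<^sub>M N) = ereal (F - s * (\<integral>p. cost p \<partial>\<gamma>))"
    by (simp add: l_integral[OF \<gamma>])
  \<comment> \<open>The entropy, weighted by 1/s, contains minus the transport cost, so the cost of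
    \<gamma> cancels.\<close>
  have "optval (1 / s) \<le> (\<integral>p. cost p \<partial>\<gamma>) + (1 / s) * (F - s * (\<integral>p. cost p \<partial>\<gamma>))"
    by (rule optval_le[OF \<gamma> ent]) (use s in simp)
  also have "\<dots> = (1 / s) * F" using s by (simp add: field_simps)
  finally have "optval (1 / s) \<le> (1 / s) * F" .
  moreover have "(1 / s) * F \<le> optval (1 / s)"
  proof (rule optval_ge)
    fix \<eta> e assume \<eta>: "\<eta> \<in> couplings M N" "rel_entropy \<eta> (M \<Otimes>\<^sub>M N) = ereal e"
    have "F - s * (\<integral>p. cost p \<partial>\<eta>) \<le> e"
      using entropy_variational_le[OF prob_space_pair coupling_prob[OF \<eta>(1)] \<eta>(2) l_meas l_bound mass]
      by (simp add: l_integral[OF \<eta>(1)])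
    then show "(1 / s) * F \<le> (\<integral>p. cost p \<partial>\<eta>) + (1 / s) * e"
      using s by (simp add: field_simps)
  qed (use s in simp)
  ultimately show ?thesis by (simp add: F_def)
qed

end

section \<open>Analyticity and continuity at zero\<close>

text \<open>The complement of the support is covered by null balls; by the Lindelof property
  countably many of them have the same union.\<close>

lemma AE_measure_support:
  fixes M :: "'a::{metric_space, second_countable_topology} measure"
  assumes sets: "sets M = sets borel"
  shows "AE x in M. x \<in> measure_support M"
proof -
  define F where "F = {ball x e |x e. 0 < e \<and> emeasure M (ball x e) = 0}"
  obtain F' where F': "F' \<subseteq> F" "countable F'" "\<Union>F' = \<Union>F"
    by (rule Lindelof[of F]) (auto simp: F_def)
  have "A \<in> null_sets M" if "A \<in> F'" for A
    using F'(1) that by (auto simp: F_def null_sets_def sets)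
  then have "(\<Union>A\<in>F'. A) \<in> null_sets M" by (rule null_sets_UN'[OF F'(2)])
  then have "\<Union>F \<in> null_sets M" using F'(3) by simp
  moreover have "x \<in> \<Union>F" if "x \<notin> measure_support M" for x
  proof -
    obtain e where "0 < e" "emeasure M (ball x e) = 0"
      using \<open>x \<notin> measure_support M\<close> by (auto simp: measure_support_def zero_less_iff_neq_zero)
    then have "ball x e \<in> F" "x \<in> ball x e" by (auto simp: F_def)
    then show ?thesis by blast
  qed
  ultimately show ?thesis by (intro AE_I'[of "\<Union>F"]) auto
qed

text \<open>Finitely many balls of radius d/2 centred in \<open>X\<close> cover \<open>X\<close>,
  and the ball of radius d around a point of \<open>X\<close> contains the half-size ball of the
  cover that holds this point. A minimum over finitely many positive masses remains.\<close>

lemma compact_uniform_ball_mass: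
  fixes M :: "'a::metric_space measure"
  assumes "prob_space M" and sets: "sets M = sets borel"
    and X: "compact X" "X \<subseteq> measure_support M" and d: "0 < d"
  obtains m where "0 < m" "m \<le> 1" "\<And>x. x \<in> X \<Longrightarrow> m \<le> measure M (ball x d)"
proof -
  interpret prob_space M by fact
  obtain F where F: "F \<subseteq> X" "finite F" "X \<subseteq> (\<Union>x\<in>F. ball x (d / 2))"
  proof (rule compactE_image[OF X(1), of X "\<lambda>x. ball x (d / 2)"])
    show "X \<subseteq> (\<Union>x\<in>X. ball x (d / 2))"
    proof
      fix x assume "x \<in> X"
      then show "x \<in> (\<Union>x\<in>X. ball x (d / 2))" using d by (intro UN_I[of x]) auto
    qed
  qed auto
  \<comment> \<open>Inserting 1 keeps the minimum meaningful for an empty cover.\<close>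
  define m where "m = Min (insert 1 ((\<lambda>x. measure M (ball x (d / 2))) ` F))"
  show ?thesis
  proof
    have "0 < measure M (ball x (d / 2))" if "x \<in> F" for x
      using F(1) X(2) that d by (auto simp: measure_support_def emeasure_eq_measure)
    then show "0 < m" using F(2) by (auto simp: m_def)
    show "m \<le> 1" using F(2) by (simp add: m_def)
    fix x assume "x \<in> X"
    then obtain z where z: "z \<in> F" "dist z x < d / 2" using F(3) by auto
    have "m \<le> measure M (ball z (d / 2))" using z F(2) by (auto simp: m_def)
    also have "ball z (d / 2) \<subseteq> ball x d"
    proof
      fix y assume "y \<in> ball z (d / 2)"
      then show "y \<in> ball x d" using z(2) dist_triangle3[of x y z] by simp
    qed
    then have "measure M (ball z (d / 2)) \<le> measure M (ball x d)"
      by (intro finite_measure_mono) (auto simp: sets)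
    finally show "m \<le> measure M (ball x d)" .
  qed
qed

context cost_kernel
begin

section \<open>From the dual value to power series of the transport value\<close>

lemma potentials_exist:
  assumes "0 < s"
  shows "\<exists>f g B. f \<in> borel_measurable M \<and> g \<in> borel_measurable N
    \<and> (\<forall>x. \<bar>f x\<bar> \<le> B) \<and> (\<forall>y. \<bar>g y\<bar> \<le> B)
    \<and> (\<forall>y. (\<integral>x. exp (f x + g y - s * c x y) \<partial>M) = 1)
    \<and> (\<forall>x. (\<integral>y. exp (f x + g y - s * c x y) \<partial>N) = 1)
    \<and> optval (1 / s) = (1 / s) * ((\<integral>x. f x \<partial>M) + (\<integral>y. g y \<partial>N))"
proof -
  interpret s: cost_kernel M N c C "s + 1"
    using space_M space_N c_meas c_bound C_pos assms by unfold_locales auto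
  obtain f g B where fg: "f \<in> borel_measurable M" "g \<in> borel_measurable N"
    "\<And>x. \<bar>f x\<bar> \<le> B" "\<And>y. \<bar>g y\<bar> \<le> B"
    "\<And>y. (\<integral>x. exp (f x + g y - s * c x y) \<partial>M) = 1"
    "\<And>x. (\<integral>y. exp (f x + g y - s * c x y) \<partial>N) = 1"
    using s.schroedinger_potentials[of s] assms by auto
  show ?thesis using optval_duality[OF assms fg] fg by blast
qed

lemma optval_eq_dual_value:
  assumes "0 < s" "s < R"
  shows "optval (1 / s) = Re (dual_value (of_real s)) / s"
proof -
  obtain f g B where fg: "f \<in> borel_measurable M" "g \<in> borel_measurable N"
    "\<And>x. \<bar>f x\<bar> \<le> B" "\<And>y. \<bar>g y\<bar> \<le> B"
    "\<And>y. (\<integral>x. exp (f x + g y - s * c x y) \<partial>M) = 1"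
    "\<And>x. (\<integral>y. exp (f x + g y - s * c x y) \<partial>N) = 1"
    and d: "dual_value (of_real s) = of_real ((\<integral>x. f x \<partial>M) + (\<integral>y. g y \<partial>N))"
    using schroedinger_potentials[of s] assms by auto
  show ?thesis using optval_duality[OF assms(1) fg] by (simp add: d)
qed

lemma optval_power_series:
  assumes e: "0 < e" and eR: "1 / e < R"
  shows "\<exists>r>0. \<exists>a::nat \<Rightarrow> real. \<forall>y. \<bar>y - e\<bar> < r \<longrightarrow> (\<lambda>n. a n * (y - e) ^ n) sums optval y"
proof -
  define S where "S = {z::complex. z \<noteq> 0 \<and> inverse z \<in> \<Omega>}"
  define k where "k = (\<lambda>z. z * dual_value (inverse z))"
  have "open ((- {0}) \<inter> inverse -` \<Omega> :: complex set)"
    by (rule continuous_open_preimage) (auto intro!: continuous_intros open_Omega)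
  also have "(- {0}) \<inter> inverse -` \<Omega> = S" by (auto simp: S_def)
  finally have "open S" .
  moreover have "complex_of_real e \<in> S"
    using e eR of_real_in_Omega[of "inverse e"] by (simp add: S_def inverse_eq_divide)
  ultimately obtain r0 where r0: "0 < r0" "ball (complex_of_real e) r0 \<subseteq> S"
    using open_contains_ball by blast
  \<comment> \<open>Besides staying inside \<open>S\<close>, the disc must meet the real axis only
    in positive numbers, where \<open>optval\<close> agrees with \<open>k\<close>.\<close>
  define r where "r = min r0 e"
  have sub: "ball (complex_of_real e) r \<subseteq> S" using r0(2) by (auto simp: r_def)
  have S: "z \<noteq> 0" "inverse z \<in> \<Omega>" if "z \<in> ball (complex_of_real e) r" for z
    using subsetD[OF sub that] unfolding S_def by blast+
  have "(\<lambda>z. dual_value (inverse z)) holomorphic_on ball (complex_of_real e) r"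
  proof (rule holomorphic_on_compose_gen[OF _ dual_value_holomorphic, unfolded o_def])
    show "inverse holomorphic_on ball (complex_of_real e) r"
      by (intro holomorphic_on_inverse holomorphic_on_ident S(1))
    show "inverse ` ball (complex_of_real e) r \<subseteq> \<Omega>" using S(2) by blast
  qed
  then have hol: "k holomorphic_on ball (complex_of_real e) r"
    unfolding k_def by (intro holomorphic_intros)
  \<comment> \<open>Powers of the real number y - e are real, so taking real parts of the complex
    expansion amounts to taking them of the coefficients.\<close>
  define a where "a = (\<lambda>n. Re ((deriv ^^ n) k (of_real e) / fact n))"
  have "(\<lambda>n. a n * (y - e) ^ n) sums optval y" if y: "\<bar>y - e\<bar> < r" for y
  proof -
    have in_ball: "complex_of_real y \<in> ball (complex_of_real e) r"
      using y by (simp add: dist_norm abs_minus_commute flip: of_real_diff)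
    have "0 < y" using y by (auto simp: r_def abs_less_iff)
    moreover have "inverse (complex_of_real y) \<in> \<Omega>" using S(2)[OF in_ball] .
    then have "inverse y < R" using \<open>0 < y\<close> by (simp add: \<Omega>_def flip: of_real_inverse)
    ultimately have "optval (1 / inverse y) = Re (dual_value (of_real (inverse y))) / inverse y"
      by (intro optval_eq_dual_value) auto
    then have "optval y = Re (k (of_real y))"
      using \<open>0 < y\<close> by (simp add: k_def field_simps)
    moreover have "(\<lambda>n. Re ((deriv ^^ n) k (of_real e) / fact n * (of_real y - of_real e) ^ n))
        sums Re (k (of_real y))"
      by (rule sums_Re[OF holomorphic_power_series[OF hol in_ball]])
    moreover have "Re ((deriv ^^ n) k (of_real e) / fact n * (of_real y - of_real e) ^ n)
        = a n * (y - e) ^ n" for n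
      unfolding a_def of_real_diff[symmetric] of_real_power[symmetric]
      by (simp only: times_complex.sel Re_complex_of_real Im_complex_of_real mult_zero_right diff_zero)
    ultimately show ?thesis by simp
  qed
  moreover have "0 < r" using r0 e by (simp add: r_def)
  ultimately show ?thesis by blast
qed

lemma optval_real_analytic: "real_analytic_on optval {0<..}"
  unfolding real_analytic_on_def
proof
  fix e :: real assume e: "e \<in> {0<..}"
  \<comment> \<open>This bound places the inverse temperature 1/e strictly inside the range;
    \<open>optval\<close> is the same function for every bound.\<close>
  interpret e: cost_kernel M N c C "1 / e + 1"
    using space_M space_N c_meas c_bound C_pos e by unfold_locales (auto intro: add_pos_pos)
  show "\<exists>r>0. \<exists>a. \<forall>y. \<bar>y - e\<bar> < r \<longrightarrow> (\<lambda>n. a n * (y - e) ^ n) sums optval y"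
    using e.optval_power_series[of e] e by simp
qed

section \<open>Continuity at zero\<close>

text \<open>If f(x) + g(y) exceeded s c(x,y) by much, it would do so on all of \<open>A\<close> up
  to 2 s \<eta>, and the integral over \<open>A\<close> alone would exceed the total 1 prescribed by
  the equation over \<open>M\<close>. One s \<eta> pays for moving \<open>f\<close> from x to x',
  the other for moving the cost; the mass of \<open>A\<close> costs -ln m.\<close>

lemma potentials_sum_le:
  fixes X :: "'a set" and Y :: "'b set" and A :: "'a set"
  assumes s: "0 < s"
    and [measurable]: "f \<in> borel_measurable M" "g \<in> borel_measurable N"
    and fB: "\<And>x. \<bar>f x\<bar> \<le> B" and gB: "\<And>y. \<bar>g y\<bar> \<le> B"
    and Mint: "\<And>y. (\<integral>x. exp (f x + g y - s * c x y) \<partial>M) = 1"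
    and Nint: "\<And>x. (\<integral>y. exp (f x + g y - s * c x y) \<partial>N) = 1"
    and AE_X: "AE x in M. x \<in> X" and AE_Y: "AE y in N. y \<in> Y"
    and A: "A \<in> sets M" and m: "0 < m" "m \<le> measure M A"
    and near: "\<And>x' y. x' \<in> A \<Longrightarrow> x' \<in> X \<Longrightarrow> y \<in> Y \<Longrightarrow> \<bar>c x y - c x' y\<bar> \<le> \<eta>"
    and y: "y \<in> Y"
  shows "f x + g y \<le> s * c x y + 2 * (s * \<eta>) - ln m"
proof -
  note [measurable] = A
  have sc: "\<bar>s * c x y\<bar> \<le> s * C" for x y
    unfolding abs_mult using c_bound s by (intro mult_mono) auto
  have exponent: "exp (f x + g y - s * c x y) \<le> exp (B + B + s * C)" for x y
    using fB[of x] gB[of y] sc[of x y] by (simp add: abs_le_iff)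
  have c_meas2 [measurable]: "(\<lambda>y. c x y) \<in> borel_measurable N" for x
    by (rule cost_kernel.c_measurable1[OF swap])
  have int_N: "integrable N (\<lambda>y. exp (f z + g y - s * c z y))" for z
    by (rule N.bounded_integrable[where B = "exp (B + B + s * C)"]) (use exponent in auto)
  have int_M: "integrable M (\<lambda>z. exp (f z + g y - s * c z y))"
    by (rule M.bounded_integrable[where B = "exp (B + B + s * C)"]) (use exponent in auto)
  \<comment> \<open>The equation over \<open>N\<close> makes \<open>f\<close> inherit the modulus of
    the cost: the integrands at x' and x differ by at most the factor exp(f x' - f x + s \<eta>),
    while both integrals are 1.\<close>
  have f_near: "f x - s * \<eta> \<le> f x'" if x': "x' \<in> A" "x' \<in> X" for x'
  proof -
    have "(\<integral>y. exp (f x' + g y - s * c x' y) \<partial>N)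
        \<le> (\<integral>y. exp (f x' - f x + s * \<eta>) * exp (f x + g y - s * c x y) \<partial>N)"
    proof (intro integral_mono_AE integrable_mult_right int_N)
      show "AE y in N. exp (f x' + g y - s * c x' y)
          \<le> exp (f x' - f x + s * \<eta>) * exp (f x + g y - s * c x y)"
        using AE_Y
      proof eventually_elim
        fix y assume "y \<in> Y"
        then have "c x y - c x' y \<le> \<eta>" using near[OF x'] by (simp add: abs_le_iff)
        then have "s * (c x y - c x' y) \<le> s * \<eta>" using s by simp
        then show "exp (f x' + g y - s * c x' y)
          \<le> exp (f x' - f x + s * \<eta>) * exp (f x + g y - s * c x y)"
          by (simp add: algebra_simps flip: exp_add)
      qed
    qed
    then show ?thesis by (simp add: Nint)
  qed
  define k where "k = f x + g y - s * c x y - 2 * (s * \<eta>)"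
  have "(\<integral>x'. exp k * indicator A x' \<partial>M) \<le> (\<integral>x'. exp (f x' + g y - s * c x' y) \<partial>M)"
  proof (rule integral_mono_AE[OF _ int_M])
    show "integrable M (\<lambda>x'. exp k * indicator A x')" by (simp add: M.emeasure_eq_measure)
    show "AE x' in M. exp k * indicator A x' \<le> exp (f x' + g y - s * c x' y)"
      using AE_X
    proof eventually_elim
      fix x' assume x': "x' \<in> X"
      show "exp k * indicator A x' \<le> exp (f x' + g y - s * c x' y)"
      proof (cases "x' \<in> A")
        case True
        have "c x' y - c x y \<le> \<eta>" using near[OF True x' y] by (simp add: abs_le_iff)
        then have "s * (c x' y - c x y) \<le> s * \<eta>" using s by simp
        then show ?thesis using f_near[OF True x'] True by (simp add: k_def algebra_simps)
      qed simp
    qed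
  qed
  then have "exp k * measure M A \<le> 1" by (simp add: Mint)
  moreover have "exp k * m \<le> exp k * measure M A" using m by simp
  ultimately have "exp k * m \<le> 1" by linarith
  then have "ln (exp k * m) \<le> ln 1" using m by (subst ln_le_cancel_iff) auto
  then have "k + ln m \<le> 0" using m by (simp add: ln_mult)
  then show ?thesis by (simp add: k_def)
qed

lemma optval_le_at_0:
  assumes "0 < \<epsilon>" shows "optval 0 \<le> optval \<epsilon>"
  using optval_mono assms by (auto simp: mono_on_def)

text \<open>The pointwise bound on the potentials is integrated against an arbitrary coupling, of
  finite entropy or not, and multiplied by \<epsilon> = 1/s: the modulus term becomes 2 \<eta>,
  independent of \<epsilon>, and the mass term becomes -\<epsilon> ln m, which vanishes with
  \<epsilon>.\<close>

lemma optval_upper_bound: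
  fixes X :: "'a set" and Y :: "'b set" and A :: "'a \<Rightarrow> 'a set"
  assumes e: "0 < \<epsilon>" and AE_X: "AE x in M. x \<in> X" and AE_Y: "AE y in N. y \<in> Y"
    and A: "\<And>x. A x \<in> sets M" and m: "0 < m" "\<And>x. x \<in> X \<Longrightarrow> m \<le> measure M (A x)"
    and near: "\<And>x x' y. x \<in> X \<Longrightarrow> x' \<in> A x \<Longrightarrow> x' \<in> X \<Longrightarrow> y \<in> Y \<Longrightarrow> \<bar>c x y - c x' y\<bar> \<le> \<eta>"
  shows "optval \<epsilon> \<le> optval 0 + 2 * \<eta> - \<epsilon> * ln m"
proof -
  define s where "s = 1 / \<epsilon>"
  have s: "0 < s" using e by (simp add: s_def)
  obtain f g B where f_meas: "f \<in> borel_measurable M" and g_meas: "g \<in> borel_measurable N"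
    and bd: "\<And>x. \<bar>f x\<bar> \<le> B" "\<And>y. \<bar>g y\<bar> \<le> B"
    and norm: "\<And>y. (\<integral>x. exp (f x + g y - s * c x y) \<partial>M) = 1"
      "\<And>x. (\<integral>y. exp (f x + g y - s * c x y) \<partial>N) = 1"
    and ws: "optval (1 / s) = (1 / s) * ((\<integral>x. f x \<partial>M) + (\<integral>y. g y \<partial>N))"
    using potentials_exist[OF s] by blast
  have "optval \<epsilon> - 2 * \<eta> + \<epsilon> * ln m \<le> optval 0"
  proof (rule optval_0_ge)
    fix \<gamma> assume \<gamma>: "\<gamma> \<in> couplings M N"
    interpret \<gamma>: prob_space \<gamma> by (rule coupling_prob[OF \<gamma>])
    have meas: "fst \<in> \<gamma> \<rightarrow>\<^sub>M M" "snd \<in> \<gamma> \<rightarrow>\<^sub>M N" and marg: "distr \<gamma> M fst = M" "distr \<gamma> N snd = N"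
      using \<gamma> measurable_cong_sets[of \<gamma> "M \<Otimes>\<^sub>M N"] by (auto simp: couplings_def)
    have "AE p in \<gamma>. fst p \<in> X" using AE_X by (intro AE_distrD[OF meas(1)]) (simp only: marg)
    moreover have "AE p in \<gamma>. snd p \<in> Y" using AE_Y by (intro AE_distrD[OF meas(2)]) (simp only: marg)
    ultimately have ae: "AE p in \<gamma>. f (fst p) + g (snd p) \<le> s * cost p + (2 * (s * \<eta>) - ln m)"
    proof eventually_elim
      fix p assume p: "fst p \<in> X" "snd p \<in> Y"
      have "f (fst p) + g (snd p) \<le> s * cost p + 2 * (s * \<eta>) - ln m"
        by (rule potentials_sum_le[OF s f_meas g_meas bd norm AE_X AE_Y A m(1) m(2)[OF p(1)] near[OF p(1)] p(2)])
      then show "f (fst p) + g (snd p) \<le> s * cost p + (2 * (s * \<eta>) - ln m)" by simp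
    qed
    note marginals = couplings_marginals[OF \<gamma> f_meas bd(1) g_meas bd(2)]
    have "(\<integral>p. f (fst p) + g (snd p) \<partial>\<gamma>) \<le> (\<integral>p. s * cost p + (2 * (s * \<eta>) - ln m) \<partial>\<gamma>)"
      by (rule integral_mono_AE[OF _ _ ae]) (use marginals cost_integrable[OF \<gamma>] in auto)
    then have "(\<integral>x. f x \<partial>M) + (\<integral>y. g y \<partial>N) \<le> s * (\<integral>p. cost p \<partial>\<gamma>) + (2 * (s * \<eta>) - ln m)"
      using marginals cost_integrable[OF \<gamma>] by (simp add: \<gamma>.prob_space)
    then have "\<epsilon> * ((\<integral>x. f x \<partial>M) + (\<integral>y. g y \<partial>N)) \<le> \<epsilon> * (s * (\<integral>p. cost p \<partial>\<gamma>) + (2 * (s * \<eta>) - ln m))"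
      using e by (intro mult_left_mono) auto
    moreover have "optval \<epsilon> = \<epsilon> * ((\<integral>x. f x \<partial>M) + (\<integral>y. g y \<partial>N))" using ws by (simp add: s_def)
    moreover have "\<epsilon> * s = 1" using e by (simp add: s_def)
    then have "\<epsilon> * (s * (\<integral>p. cost p \<partial>\<gamma>) + (2 * (s * \<eta>) - ln m))
        = (\<integral>p. cost p \<partial>\<gamma>) + 2 * \<eta> - \<epsilon> * ln m"
      by (simp add: distrib_left right_diff_distrib mult.left_commute[of _ 2] flip: mult.assoc)
    ultimately show "optval \<epsilon> - 2 * \<eta> + \<epsilon> * ln m \<le> (\<integral>p. cost p \<partial>\<gamma>)" by simp
  qed
  then show ?thesis by simp
qed

text \<open>Inside the half-line concavity suffices. At 0 the value is squeezed between monotonicity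
  and the assumed bound; the slope \<open>K\<close> may depend on \<open>e\<close>, which is fixed
  before \<epsilon> tends to 0.\<close>

lemma optval_continuous:
  assumes small: "\<And>e. 0 < e \<Longrightarrow> \<exists>K. \<forall>\<epsilon>>0. optval \<epsilon> \<le> optval 0 + e + \<epsilon> * K"
  shows "continuous_on {0..} optval"
proof -
  have "convex_on {0<..} (\<lambda>x. - optval x)"
    using optval_concave unfolding concave_on_def by (rule convex_on_subset) auto
  then have "continuous_on {0<..} (\<lambda>x. - (- optval x))"
    by (intro continuous_on_minus convex_on_continuous) auto
  then have cont: "isCont optval x" if "0 < x" for x
    using that by (simp add: continuous_on_eq_continuous_at)
  have "(optval \<longlongrightarrow> optval 0) (at 0 within {0..})"
  proof (rule tendstoI)
    fix e :: real assume e: "0 < e"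
    obtain K where K: "\<And>\<epsilon>. 0 < \<epsilon> \<Longrightarrow> optval \<epsilon> \<le> optval 0 + e / 2 + \<epsilon> * K"
      using small[of "e / 2"] e by auto
    have "((\<lambda>\<epsilon>. \<epsilon> * K) \<longlongrightarrow> 0 * K) (at 0 within {0..})" by (intro tendsto_intros)
    then have "\<forall>\<^sub>F \<epsilon> in at 0 within {0..}. \<epsilon> * K < e / 2"
      using e by (intro order_tendstoD) auto
    moreover have "\<forall>\<^sub>F \<epsilon> in at (0::real) within {0..}. 0 < \<epsilon>"
      by (auto simp: eventually_at_filter)
    ultimately show "\<forall>\<^sub>F \<epsilon> in at 0 within {0..}. dist (optval \<epsilon>) (optval 0) < e"
    proof eventually_elim
      fix \<epsilon> assume "\<epsilon> * K < e / 2" "0 < \<epsilon>"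
      then show "dist (optval \<epsilon>) (optval 0) < e"
        using K[of \<epsilon>] optval_le_at_0[of \<epsilon>] by (simp add: dist_real_def)
    qed
  qed
  then have "continuous (at 0 within {0..}) optval" by (simp add: continuous_within)
  then show ?thesis
    unfolding continuous_on_eq_continuous_within
    using cont continuous_at_imp_continuous_within by (metis atLeast_iff order_le_less)
qed

end

section \<open>Transfer to compactly supported measures and a cost continuous on their
  supports\<close>

theorem theorem2p1:
  fixes \<mu>m \<mu>p :: "'a::euclidean_space measure" and c :: "'a \<times> 'a \<Rightarrow> real"
  assumes "prob_space \<mu>m" and "prob_space \<mu>p"
    and "sets \<mu>m = sets borel" and "sets \<mu>p = sets borel"
    and "compact (measure_support \<mu>m)" and "compact (measure_support \<mu>p)"
    and "continuous_on (measure_support \<mu>m \<times> measure_support \<mu>p) c"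
  defines "v \<equiv> \<lambda>\<epsilon>. ot_value \<mu>m \<mu>p (measure_support \<mu>m) (measure_support \<mu>p) c \<epsilon>"
  shows "(\<forall>\<epsilon>\<ge>0. \<bar>v \<epsilon>\<bar> \<noteq> \<infinity>)
    \<and> continuous_on {0..} (\<lambda>\<epsilon>. real_of_ereal (v \<epsilon>))
    \<and> mono_on {0..} (\<lambda>\<epsilon>. real_of_ereal (v \<epsilon>))
    \<and> concave_on {0..} (\<lambda>\<epsilon>. real_of_ereal (v \<epsilon>))
    \<and> real_analytic_on (\<lambda>\<epsilon>. real_of_ereal (v \<epsilon>)) {0<..}"
proof -
  define X Y where "X = measure_support \<mu>m" and "Y = measure_support \<mu>p"
  have X: "compact X" and Y: "compact Y" and cont: "continuous_on (X \<times> Y) c"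
    using assms by (simp_all add: X_def Y_def)
  have XY: "compact (X \<times> Y)" using X Y by (rule compact_Times)
  \<comment> \<open>The extension by 0 is bounded and Borel on the whole space, and its integral is
    by definition the set integral of \<open>c\<close> over the product of the supports.\<close>
  define k where "k = (\<lambda>x y. indicator (X \<times> Y) (x, y) * c (x, y))"
  have "bounded (c ` (X \<times> Y))" using compact_continuous_image[OF cont XY] compact_imp_bounded by blast
  then obtain C where C: "0 < C" "\<And>p. p \<in> X \<times> Y \<Longrightarrow> \<bar>c p\<bar> \<le> C"
    unfolding bounded_pos by auto
  have sets_pair: "sets (\<mu>m \<Otimes>\<^sub>M \<mu>p) = sets borel"
    unfolding sets_pair_measure_cong[OF assms(3,4)] borel_prod ..
  interpret \<mu>m: prob_space \<mu>m by fact
  interpret \<mu>p: prob_space \<mu>p by fact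
  \<comment> \<open>The value 1 for \<open>R\<close> is arbitrary: the conclusions drawn below are
    free of \<open>R\<close>.\<close>
  interpret cost_kernel \<mu>m \<mu>p k C 1
  proof
    show "space \<mu>m = UNIV" "space \<mu>p = UNIV"
      using sets_eq_imp_space_eq[OF assms(3)] sets_eq_imp_space_eq[OF assms(4)] by simp_all
    have "(\<lambda>p. indicator (X \<times> Y) p *\<^sub>R c p) \<in> borel_measurable borel"
      by (rule borel_measurable_continuous_on_indicator[OF _ cont])
         (use XY in \<open>simp add: borel_closed compact_imp_closed\<close>)
    then show "(\<lambda>(x, y). k x y) \<in> borel_measurable (\<mu>m \<Otimes>\<^sub>M \<mu>p)"
      unfolding measurable_cong_sets[OF sets_pair refl] by (simp add: k_def case_prod_unfold)
    show "\<bar>k x y\<bar> \<le> C" for x y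
      using C by (auto simp: k_def indicator_def less_imp_le)
  qed (use C in auto)
  have v: "v \<epsilon> = transport_value \<epsilon>" for \<epsilon>
    unfolding v_def ot_value_def transport_value_def X_def[symmetric] Y_def[symmetric]
    by (simp add: set_lebesgue_integral_def k_def)
  have AE: "AE x in \<mu>m. x \<in> X" "AE y in \<mu>p. y \<in> Y"
    unfolding X_def Y_def by (rule AE_measure_support; fact)+
  have "\<exists>K. \<forall>\<epsilon>>0. optval \<epsilon> \<le> optval 0 + e + \<epsilon> * K" if e: "0 < e" for e
  proof -
    have "uniformly_continuous_on (X \<times> Y) c" by (rule compact_uniformly_continuous[OF cont XY])
    \<comment> \<open>The tolerance e/2 compensates for the term 2 \<eta> in
      \<open>optval_upper_bound\<close>.\<close>
    then obtain d where d: "0 < d" "\<And>p p'. p \<in> X \<times> Y \<Longrightarrow> p' \<in> X \<times> Y \<Longrightarrow> dist p' p < d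
        \<Longrightarrow> dist (c p') (c p) < e / 2"
      using e unfolding uniformly_continuous_on_def by (metis half_gt_zero)
    obtain m where m: "0 < m" "\<And>x. x \<in> X \<Longrightarrow> m \<le> measure \<mu>m (ball x d)"
      using compact_uniform_ball_mass[OF assms(1,3) X _ d(1)] by (auto simp: X_def)
    have "optval \<epsilon> \<le> optval 0 + e + \<epsilon> * (- ln m)" if "0 < \<epsilon>" for \<epsilon>
    proof -
      have "optval \<epsilon> \<le> optval 0 + 2 * (e / 2) - \<epsilon> * ln m"
      proof (rule optval_upper_bound[OF that AE, where A = "\<lambda>x. ball x d"])
        fix x x' y assume *: "x \<in> X" "x' \<in> ball x d" "x' \<in> X" "y \<in> Y"
        then have "dist (c (x, y)) (c (x', y)) < e / 2"
          by (intro d(2)) (auto simp: dist_Pair_Pair)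
        then show "\<bar>k x y - k x' y\<bar> \<le> e / 2" using * by (simp add: k_def dist_real_def)
      qed (use m in \<open>auto simp: assms(3)\<close>)
      then show ?thesis by simp
    qed
    then show ?thesis by blast
  qed
  then have "continuous_on {0..} optval" by (rule optval_continuous)
  moreover have vw: "(\<lambda>\<epsilon>. real_of_ereal (v \<epsilon>)) = optval" by (simp add: v optval_def fun_eq_iff)
  ultimately show ?thesis
    unfolding vw using optval_mono optval_concave optval_real_analytic transport_value_finite(1) by (simp add: v)
qed

end
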